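(* Let $\mathfrak{g}$ be any non-Abelian (finite-dimensional) complex unimodular solvable Lie algebra. Then $\mathfrak{g}$ admits a non-vanishing triple ABC--Massey product.
   Context: A complex Lie algebra $\mathfrak{g}$ of complex dimension $n$ is regarded as a real Lie algebra of dimension $2n$ with complex structure $J$ given by multiplication by $\sqrt{-1}$ (which is integrable since the bracket is complex bilinear). $\mathfrak{g}$ is unimodular if $\operatorname{tr}(\operatorname{ad}_x)=0$ for all $x\in\mathfrak{g}$. Let $\mathfrak{g}^*$ be the real dual and $\mathfrak{g}^*_{\mathbb{C}}=\mathfrak{g}^*\otimes_{\mathbb{R}}\mathbb{C}=(\mathfrak{g}^*_{\mathbb{C}})^{1,0}\oplus(\mathfrak{g}^*_{\mathbb{C}})^{0,1}$ the decomposition into the $\pm\sqrt{-1}$-eigenspaces of $J$; put $\bigwedge^{p,q}\mathfrak{g}^*=\bigwedge^p(\mathfrak{g}^*_{\mathbb{C}})^{1,0}\otimes\bigwedge^q(\mathfrak{g}^*_{\mathbb{C}})^{0,1}$ (equal to $0$ if $p<0$ or $q<0$). The Chevalley--Eilenberg differential, determined by $d\alpha(u,v)=-\alpha([u,v])$ for $\alpha\in\mathfrak{g}^*_{\mathbb{C}}$, decomposes as $d=\partial+\overline{\partial}$ with $\partial,\overline{\partial}$ of bidegrees $(1,0),(0,1)$. The Bott--Chern and Aeppli cohomologies of $\mathfrak{g}$ are $$H^{p,q}_{BC}(\mathfrak{g})=\frac{\ker\partial\cap\ker\overline{\partial}\cap\bigwedge^{p,q}\mathfrak{g}^*}{\operatorname{im}\partial\overline{\partial}\cap\bigwedge^{p,q}\mathfrak{g}^*},\qquad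 H^{p,q}_{A}(\mathfrak{g})=\frac{\ker\partial\overline{\partial}\cap\bigwedge^{p,q}\mathfrak{g}^*}{(\operatorname{im}\partial+\operatorname{im}\overline{\partial})\cap\bigwedge^{p,q}\mathfrak{g}^*}.$$ The wedge product induces a product $\cup$ on $H_{BC}$ and an $H_{BC}$-bimodule structure $\cup$ on $H_A$. Triple ABC--Massey products. Let $\mathfrak{a}_{12}=[\alpha_{12}]\in H^{p,q}_{BC}(\mathfrak{g})$, $\mathfrak{a}_{23}=[\alpha_{23}]\in H^{r,s}_{BC}(\mathfrak{g})$, $\mathfrak{a}_{34}=[\alpha_{34}]\in H^{u,v}_{BC}(\mathfrak{g})$ satisfy $\mathfrak{a}_{12}\cup\mathfrak{a}_{23}=0$ and $\mathfrak{a}_{23}\cup\mathfrak{a}_{34}=0$, that is, $$(-1)^{p+q}\alpha_{12}\wedge\alpha_{23}=\partial\overline{\partial}f_{13},\qquad (-1)^{r+s}\alpha_{23}\wedge\alpha_{34}=\partial\overline{\partial}f_{24}$$ for some $f_{13}\in\bigwedge^{p+r-1,q+s-1}\mathfrak{g}^*$ and $f_{24}\in\bigwedge^{r+u-1,s+v-1}\mathfrak{g}^*$. The triple ABC--Massey product is $$\langle\mathfrak{a}_{12},\mathfrak{a}_{23},\mathfrak{a}_{34}\rangle_{ABC}=[(-1)^{p+q}\alpha_{12}\wedge f_{24}-(-1)^{r+s}f_{13}\wedge\alpha_{34}]\in\frac{H_A^{p+r+u-1,q+s+v-1}(\mathfrak{g})}{\mathfrak{a}_{12}\cup H_A^{r+u-1,s+v-1}(\mathfrak{g})+H_A^{p+r-1,q+s-1}(\mathfrak{g})\cup\mathfrak{a}_{34}}.$$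 It is non-vanishing if it is a nonzero element of this quotient. "$\mathfrak{g}$ admits a non-vanishing triple ABC--Massey product" means that there exist such classes with $\langle\mathfrak{a}_{12},\mathfrak{a}_{23},\mathfrak{a}_{34}\rangle_{ABC}\neq 0$. *)

theory Defs
  imports Complex_Main "HOL-Library.Function_Algebras" "HOL-Library.Set_Algebras"
begin

section \<open>Complex Lie algebras\<close>

locale complex_lie_algebra =
  finite_dimensional_vector_space scale Basis
  for scale :: "complex \<Rightarrow> 'a::ab_group_add \<Rightarrow> 'a" and Basis :: "'a set" +
  fixes bracket :: "'a \<Rightarrow> 'a \<Rightarrow> 'a"
  assumes bracket_linear_left: "Vector_Spaces.linear scale scale (\<lambda>x. bracket x y)"
    and bracket_linear_right: "Vector_Spaces.linear scale scale (\<lambda>y. bracket x y)"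
    and bracket_self: "bracket x x = 0"
    and jacobi: "bracket x (bracket y z) + bracket y (bracket z x) + bracket z (bracket x y) = 0"
begin

definition abelian :: bool where
  "abelian \<longleftrightarrow> (\<forall>x y. bracket x y = 0)"

text \<open>The trace is the sum of the diagonal coefficients with respect to \<open>Basis\<close>;
  as usual it does not depend on the choice of the basis.\<close>
definition trace_endo :: "('a \<Rightarrow> 'a) \<Rightarrow> complex" where
  "trace_endo f = (\<Sum>b\<in>Basis. representation Basis (f b) b)"

definition unimodular :: bool where
  "unimodular \<longleftrightarrow> (\<forall>x. trace_endo (bracket x) = 0)"

primrec derived_series :: "nat \<Rightarrow> 'a set" where
  "derived_series 0 = UNIV"
| "derived_series (Suc k) = span {bracket x y | x y. x \<in> derived_series k \<and> y \<in> derived_series k}"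

definition solvable :: bool where
  "solvable \<longleftrightarrow> (\<exists>k. derived_series k = {0})"

end


section \<open>Exterior forms\<close>

text \<open>A complex-valued alternating \<open>k\<close>-linear form is represented by its values on argument
  lists of length \<open>k\<close>, so an inhomogeneous form is a function on lists of all lengths.
  Addition of forms is pointwise (\<^theory>\<open>HOL-Library.Function_Algebras\<close>).  The pointwise
  product and constant \<open>1\<close> which that theory also provides play no role;
  the exterior product is \<open>wedge\<close>, with unit \<open>unit_form\<close>.\<close>
type_synonym 'a form = "'a list \<Rightarrow> complex"

definition scale_form :: "complex \<Rightarrow> 'a form \<Rightarrow> 'a form" where
  "scale_form c \<omega> = (\<lambda>xs. c * \<omega> xs)"

interpretation form: vector_space scale_form
  by standard (auto simp: scale_form_def fun_eq_iff algebra_simps)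

definition unit_form :: "'a form" where
  "unit_form xs = (if xs = [] then 1 else 0)"

definition one_form :: "('a \<Rightarrow> complex) \<Rightarrow> 'a form" where
  "one_form \<alpha> xs = (if length xs = 1 then \<alpha> (hd xs) else 0)"

text \<open>Sum over shuffles, normalised such that \<open>(\<alpha> \<and> \<beta>)(x, y) = \<alpha> x * \<beta> y - \<alpha> y * \<beta> x\<close> for
  1-forms: \<open>I\<close> is the set of positions whose arguments are fed to the left factor, and the
  exponent counts the inversions of the shuffle.\<close>
definition wedge :: "'a form \<Rightarrow> 'a form \<Rightarrow> 'a form" where
  "wedge \<alpha> \<beta> xs =
     (\<Sum>I\<in>Pow {..<length xs}.
        (-1) ^ card {(i, j). i \<in> I \<and> j < i \<and> j \<notin> I} * \<alpha> (nths xs I) * \<beta> (nths xs (- I)))"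

definition wedge_list :: "('a \<Rightarrow> complex) list \<Rightarrow> 'a form" where
  "wedge_list \<alpha>s = foldr (\<lambda>\<alpha>. wedge (one_form \<alpha>)) \<alpha>s unit_form"

text \<open>In degree 1 this reads \<open>d\<alpha>(u, v) = - \<alpha>([u, v])\<close>; in higher degrees it is the extension
  as an antiderivation of the exterior product above.\<close>
definition CE_d :: "('a \<Rightarrow> 'a \<Rightarrow> 'a) \<Rightarrow> 'a form \<Rightarrow> 'a form" where
  "CE_d bracket \<omega> xs =
     (\<Sum>j<length xs. \<Sum>i<j.
        (-1) ^ (i + j) * \<omega> (bracket (xs ! i) (xs ! j) # nths xs (- {i, j})))"


section \<open>The bigraded complex of a complex Lie algebra\<close>

context complex_lie_algebra
begin

text \<open>The complexified real dual, identified with the real-linear maps to the complex numbers.\<close>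
definition dual_C :: "('a \<Rightarrow> complex) set" where
  "dual_C = {\<alpha>. Vector_Spaces.linear (\<lambda>r. scale (of_real r)) (*\<^sub>R) \<alpha>}"

definition J :: "'a \<Rightarrow> 'a" where
  "J x = scale \<i> x"

definition dual_10 :: "('a \<Rightarrow> complex) set" where
  "dual_10 = {\<alpha> \<in> dual_C. \<forall>x. \<alpha> (J x) = \<i> * \<alpha> x}"

definition dual_01 :: "('a \<Rightarrow> complex) set" where
  "dual_01 = {\<alpha> \<in> dual_C. \<forall>x. \<alpha> (J x) = - \<i> * \<alpha> x}"

definition Ext :: "'a form set" where
  "Ext = form.span {wedge_list \<alpha>s | \<alpha>s. set \<alpha>s \<subseteq> dual_C}"

text \<open>For negative \<open>p\<close> or \<open>q\<close> there are no generators and the span is zero.\<close>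
definition \<Lambda> :: "int \<Rightarrow> int \<Rightarrow> 'a form set" where
  "\<Lambda> p q = form.span {wedge_list (\<alpha>s @ \<beta>s) | \<alpha>s \<beta>s.
     int (length \<alpha>s) = p \<and> set \<alpha>s \<subseteq> dual_10 \<and> int (length \<beta>s) = q \<and> set \<beta>s \<subseteq> dual_01}"

text \<open>The \<open>(p, q)\<close>-component of a form, with respect to the direct sum decomposition of
  \<open>Ext\<close> into the spaces \<open>\<Lambda> p q\<close>.\<close>
definition component :: "int \<Rightarrow> int \<Rightarrow> 'a form \<Rightarrow> 'a form" where
  "component p q \<omega> = (THE \<eta>. \<eta> \<in> \<Lambda> p q \<and>
     \<omega> - \<eta> \<in> form.span (\<Union>(p', q')\<in>- {(p, q)}. \<Lambda> p' q'))"

abbreviation d :: "'a form \<Rightarrow> 'a form" where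
  "d \<equiv> CE_d bracket"

text \<open>The parts of \<open>d\<close> of bidegree \<open>(1, 0)\<close> and \<open>(0, 1)\<close>.  An element of \<open>Ext\<close> has only
  finitely many nonzero components, so the sums are finite.\<close>
definition del :: "'a form \<Rightarrow> 'a form" where
  "del \<omega> = (\<Sum>(p, q)\<in>{(p, q). component p q \<omega> \<noteq> 0}. component (p + 1) q (d (component p q \<omega>)))"

definition delbar :: "'a form \<Rightarrow> 'a form" where
  "delbar \<omega> = (\<Sum>(p, q)\<in>{(p, q). component p q \<omega> \<noteq> 0}. component p (q + 1) (d (component p q \<omega>)))"


section \<open>Bott--Chern and Aeppli cohomology\<close>

text \<open>Elements of a quotient \<open>V / W\<close> are the cosets \<open>v +o W\<close>; its zero element is \<open>W\<close>.\<close>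

definition Z_BC :: "int \<Rightarrow> int \<Rightarrow> 'a form set" where
  "Z_BC p q = {\<omega> \<in> \<Lambda> p q. del \<omega> = 0 \<and> delbar \<omega> = 0}"

definition B_BC :: "int \<Rightarrow> int \<Rightarrow> 'a form set" where
  "B_BC p q = (\<lambda>\<omega>. del (delbar \<omega>)) ` Ext \<inter> \<Lambda> p q"

definition H_BC :: "int \<Rightarrow> int \<Rightarrow> 'a form set set" where
  "H_BC p q = {\<omega> +o B_BC p q | \<omega>. \<omega> \<in> Z_BC p q}"

definition Z_A :: "int \<Rightarrow> int \<Rightarrow> 'a form set" where
  "Z_A p q = {\<omega> \<in> \<Lambda> p q. del (delbar \<omega>) = 0}"

definition B_A :: "int \<Rightarrow> int \<Rightarrow> 'a form set" where
  "B_A p q = (del ` Ext + delbar ` Ext) \<inter> \<Lambda> p q"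

definition H_A :: "int \<Rightarrow> int \<Rightarrow> 'a form set set" where
  "H_A p q = {\<omega> +o B_A p q | \<omega>. \<omega> \<in> Z_A p q}"

text \<open>The product of two classes with values in Aeppli cohomology of bidegree \<open>(p, q)\<close>.  It does
  not depend on the representatives, so the union consists of a single coset.\<close>
definition cup_A :: "int \<Rightarrow> int \<Rightarrow> 'a form set \<Rightarrow> 'a form set \<Rightarrow> 'a form set" where
  "cup_A p q X Y = (\<Union>\<xi>\<in>X. \<Union>\<eta>\<in>Y. wedge \<xi> \<eta> +o B_A p q)"


section \<open>Triple ABC--Massey products\<close>

text \<open>The set addition \<open>+\<close> in the next definition is that of subsets of \<open>H_A\<close>, whose elements
  are themselves added as cosets.\<close>
definition ABC_indeterminacy ::
    "nat \<Rightarrow> nat \<Rightarrow> nat \<Rightarrow> nat \<Rightarrow> nat \<Rightarrow> nat \<Rightarrow> 'a form set \<Rightarrow> 'a form set \<Rightarrow> 'a form set set" where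
  "ABC_indeterminacy p q r s u v a12 a34 =
     (\<lambda>h. cup_A (int p + int r + int u - 1) (int q + int s + int v - 1) a12 h)
       ` H_A (int r + int u - 1) (int s + int v - 1) +
     (\<lambda>h. cup_A (int p + int r + int u - 1) (int q + int s + int v - 1) h a34)
       ` H_A (int p + int r - 1) (int q + int s - 1)"

text \<open>\<open>is_ABC_Massey p q r s u v a12 a23 a34 m\<close>: the product of \<open>a12\<close>, \<open>a23\<close>, \<open>a34\<close> is
  defined and \<open>m\<close> is its value, an element of the quotient of Aeppli cohomology by
  \<open>ABC_indeterminacy\<close>.  The value does not depend on the choice of the representatives
  and of \<open>f13\<close>, \<open>f24\<close>.\<close>
definition is_ABC_Massey ::
    "nat \<Rightarrow> nat \<Rightarrow> nat \<Rightarrow> nat \<Rightarrow> nat \<Rightarrow> nat \<Rightarrow>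
     'a form set \<Rightarrow> 'a form set \<Rightarrow> 'a form set \<Rightarrow> 'a form set set \<Rightarrow> bool" where
  "is_ABC_Massey p q r s u v a12 a23 a34 m \<longleftrightarrow>
     a12 \<in> H_BC (int p) (int q) \<and> a23 \<in> H_BC (int r) (int s) \<and> a34 \<in> H_BC (int u) (int v) \<and>
     (\<exists>\<alpha>12\<in>a12. \<exists>\<alpha>23\<in>a23. \<exists>\<alpha>34\<in>a34.
      \<exists>f13\<in>\<Lambda> (int p + int r - 1) (int q + int s - 1).
      \<exists>f24\<in>\<Lambda> (int r + int u - 1) (int s + int v - 1).
        scale_form ((-1) ^ (p + q)) (wedge \<alpha>12 \<alpha>23) = del (delbar f13) \<and>
        scale_form ((-1) ^ (r + s)) (wedge \<alpha>23 \<alpha>34) = del (delbar f24) \<and>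
        m = ((scale_form ((-1) ^ (p + q)) (wedge \<alpha>12 f24)
               - scale_form ((-1) ^ (r + s)) (wedge f13 \<alpha>34))
             +o B_A (int p + int r + int u - 1) (int q + int s + int v - 1))
            +o ABC_indeterminacy p q r s u v a12 a34)"

text \<open>The zero of the quotient by \<open>ABC_indeterminacy\<close> is \<open>ABC_indeterminacy\<close> itself.\<close>
definition admits_nonvanishing_ABC_Massey :: bool where
  "admits_nonvanishing_ABC_Massey \<longleftrightarrow>
     (\<exists>p q r s u v a12 a23 a34 m. is_ABC_Massey p q r s u v a12 a23 a34 m \<and>
        m \<noteq> ABC_indeterminacy p q r s u v a12 a34)"

end

end

theory Submission
  imports Defs
begin

text \<open>Let \<open>X = [x, y]\<close> be a nonzero bracket, \<open>\<alpha>\<close> a complex linear functional with \<open>\<alpha> X \<noteq> 0\<close>,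
\<open>\<beta>\<close> its complex conjugate and \<open>vol\<close> a nonzero \<open>(n, 0)\<close>-form, where \<open>n\<close> is the complex dimension.
The three classes are those of \<open>d\<beta>\<close>, \<open>d\<alpha>\<close> and \<open>\<tau> = \<iota>\<^sub>X vol\<close>, of bidegrees \<open>(0, 2)\<close>, \<open>(2, 0)\<close> and
\<open>(n - 1, 0)\<close>.  Here \<open>\<tau>\<close> is closed because on a unimodular algebra every \<open>(n - 1, 0)\<close>-form is.  The
first product is \<open>d\<beta> \<and> d\<alpha> = del (delbar (\<beta> \<and> \<alpha>))\<close>, the second one is an \<open>(n + 1, 0)\<close>-form and so
vanishes already as a form.  The Massey product is therefore represented by
\<open>- \<beta> \<and> \<alpha> \<and> \<tau> = - \<alpha>(X) \<beta> \<and> vol\<close>, which is not zero.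

It remains to see that it does not lie in the indeterminacy.  In bidegree \<open>(n, 1)\<close> all images of
\<open>del\<close> and \<open>delbar\<close> vanish: the first ones because \<open>(n - 1, 0)\<close>-forms are closed, so that
\<open>del\<close> kills \<open>(n - 1, 1)\<close>-forms as well, the second ones because the bracket is complex
bilinear, whence \<open>delbar\<close> kills \<open>(p, 0)\<close>-forms.  Multiples of the first class would need Aeppli classes of bidegree \<open>(n, -1)\<close>, so only the forms \<open>\<xi> \<and> \<tau>\<close> with
\<open>\<xi>\<close> of bidegree \<open>(1, 1)\<close> and \<open>del (delbar \<xi>) = 0\<close> are left.  If \<open>\<xi>\<close> is regarded as a sesquilinear
pairing, then \<open>\<xi> \<and> \<tau>\<close> is, up to sign, the product of the functional \<open>\<xi>(X, \<cdot>)\<close> with \<open>vol\<close>, and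
\<open>del (delbar \<xi>) = 0\<close> says that \<open>\<xi>([a, b], [c, e]) = 0\<close> for all \<open>a\<close>, \<open>b\<close>, \<open>c\<close>, \<open>e\<close>.  Hence the functional
\<open>\<xi>(X, \<cdot>)\<close> vanishes at the bracket \<open>X\<close>, whereas for the representative above the corresponding
functional is a nonzero multiple of \<open>\<beta>\<close>, and \<open>\<beta> X \<noteq> 0\<close>.  The final step is
\<open>ABC_Massey_nonvanishing\<close>; the statement on \<open>del (delbar \<xi>)\<close> is \<open>del_delbar_bracket\<close>.

Two preparations make this rigorous.  Exterior product and differential are described by
recursions under contraction with a vector in the first slot (\<open>contract_wedge\<close>, \<open>contract_d\<close>), so
that associativity and the Leibniz rules become inductions on argument lists.  The bidegree
components, which enter the definitions of \<open>del\<close> and \<open>delbar\<close>, are unique because scaling all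
arguments by \<open>2 + \<i>\<close> acts on the forms of different bidegrees by different scalars
(\<open>\<Lambda>_sum_eq_0\<close>).\<close>

section \<open>The exterior product through contractions\<close>

definition contract :: "'a \<Rightarrow> 'a form \<Rightarrow> 'a form" where
  "contract x \<omega> = (\<lambda>xs. \<omega> (x # xs))"

definition grade_inv :: "'a form \<Rightarrow> 'a form" where
  "grade_inv \<omega> = (\<lambda>xs. (-1) ^ length xs * \<omega> xs)"

lemma wedge_Nil: "wedge \<alpha> \<beta> [] = \<alpha> [] * \<beta> []"
  by (simp add: wedge_def)

text \<open>The summands of \<open>wedge\<close> at \<open>x # xs\<close> are divided according to whether the first position belongs
to the index set; this lemma and the next three describe how the subsets, their inversions and the
selected sublists change when the first position is removed.\<close>
lemma Pow_lessThan_Suc_shift: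
  "Pow {..<Suc n} = image Suc ` Pow {..<n} \<union> (\<lambda>I. insert 0 (Suc ` I)) ` Pow {..<n}"
  by (simp add: lessThan_Suc_eq_insert_0 Pow_insert image_Pow_surj image_image flip: image_Pow_surj)

lemma inversions_insert_0:
  fixes I :: "nat set"
  shows "card {(i, j). i \<in> insert 0 (Suc ` I) \<and> j < i \<and> j \<notin> insert 0 (Suc ` I)} =
     card {(i, j). i \<in> I \<and> j < i \<and> j \<notin> I}"
proof -
  have "{(i, j). i \<in> insert 0 (Suc ` I) \<and> j < i \<and> j \<notin> insert 0 (Suc ` I)} =
     map_prod Suc Suc ` {(i, j). i \<in> I \<and> j < i \<and> j \<notin> I}"
    (is "?A = ?B")
  proof (intro equalityI subsetI)
    fix p assume "p \<in> ?A"
    then obtain i j where "p = (i, j)" "i \<in> insert 0 (Suc ` I)" "j < i" "j \<notin> insert 0 (Suc ` I)"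
      by auto
    then show "p \<in> ?B" by (cases j) auto
  qed auto
  then show ?thesis
    by (simp add: card_image inj_on_def)
qed

text \<open>If position 0 belongs to the complement, it forms one inversion with each element of the index
set.\<close>
lemma inversions_shift:
  fixes I :: "nat set"
  assumes "finite I"
  shows "card {(i, j). i \<in> Suc ` I \<and> j < i \<and> j \<notin> Suc ` I} =
     card I + card {(i, j). i \<in> I \<and> j < i \<and> j \<notin> I}"
proof -
  let ?P = "{(i, j). i \<in> I \<and> j < i \<and> j \<notin> I}"
  have eq: "{(i, j). i \<in> Suc ` I \<and> j < i \<and> j \<notin> Suc ` I} =
     (\<lambda>i. (Suc i, 0)) ` I \<union> map_prod Suc Suc ` ?P" (is "?A = ?B")
  proof (intro equalityI subsetI)
    fix p assume "p \<in> ?A"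
    then obtain i j where "p = (i, j)" "i \<in> Suc ` I" "j < i" "j \<notin> Suc ` I"
      by auto
    then show "p \<in> ?B" by (cases j) auto
  qed auto
  have "finite ?P"
    by (rule finite_subset[of _ "\<Union>i\<in>I. {i} \<times> {..<i}"]) (use assms in auto)
  then show ?thesis
    unfolding eq using assms
    by (subst card_Un_disjoint) (auto simp: card_image inj_on_def)
qed

lemma nths_shift:
  "nths (x # xs) (insert 0 (Suc ` I)) = x # nths xs I"
  "nths (x # xs) (Suc ` I) = nths xs I"
  "nths (x # xs) (- insert 0 (Suc ` I)) = nths xs (- I)"
  "nths (x # xs) (- (Suc ` I)) = x # nths xs (- I)"
proof -
  have "{j. j \<notin> I} = - I" by auto
  then show "nths (x # xs) (insert 0 (Suc ` I)) = x # nths xs I"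
    "nths (x # xs) (Suc ` I) = nths xs I"
    "nths (x # xs) (- insert 0 (Suc ` I)) = nths xs (- I)"
    "nths (x # xs) (- (Suc ` I)) = x # nths xs (- I)"
    by (simp_all add: nths_Cons inj_image_mem_iff)
qed

text \<open>The recursion behind all later computations: contraction is an antiderivation of the exterior
product.  The sign counts the inversions that \<open>x\<close> forms with the arguments of the left factor.\<close>
lemma wedge_Cons:
  "wedge \<alpha> \<beta> (x # xs) =
     wedge (contract x \<alpha>) \<beta> xs + wedge (grade_inv \<alpha>) (contract x \<beta>) xs"
proof -
  let ?n = "length xs"
  let ?t = "\<lambda>I. (-1) ^ card {(i, j). i \<in> I \<and> j < i \<and> j \<notin> I} *
     \<alpha> (nths (x # xs) I) * \<beta> (nths (x # xs) (- I))"
  have "wedge \<alpha> \<beta> (x # xs) = (\<Sum>I\<in>Pow {..<Suc ?n}. ?t I)"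
    by (simp add: wedge_def)
  also have "\<dots> = (\<Sum>I\<in>image Suc ` Pow {..<?n}. ?t I)
      + (\<Sum>I\<in>(\<lambda>I. insert 0 (Suc ` I)) ` Pow {..<?n}. ?t I)"
    unfolding Pow_lessThan_Suc_shift by (rule sum.union_disjoint) auto
  also have "(\<Sum>I\<in>image Suc ` Pow {..<?n}. ?t I) = (\<Sum>I\<in>Pow {..<?n}. ?t (Suc ` I))"
    by (rule sum.reindex_cong[OF _ refl refl]) (auto simp: inj_on_def inj_image_eq_iff)
  also have "\<dots> = wedge (grade_inv \<alpha>) (contract x \<beta>) xs"
    unfolding wedge_def
  proof (rule sum.cong[OF refl])
    fix I assume "I \<in> Pow {..<?n}"
    then have "finite I" "{i. i < ?n \<and> i \<in> I} = I" by (auto intro: finite_subset)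
    then show "?t (Suc ` I) = (-1) ^ card {(i, j). i \<in> I \<and> j < i \<and> j \<notin> I} *
        grade_inv \<alpha> (nths xs I) * contract x \<beta> (nths xs (- I))"
      by (simp add: inversions_shift nths_shift grade_inv_def contract_def length_nths power_add)
  qed
  also have "(\<Sum>I\<in>(\<lambda>I. insert 0 (Suc ` I)) ` Pow {..<?n}. ?t I) =
      (\<Sum>I\<in>Pow {..<?n}. ?t (insert 0 (Suc ` I)))"
    by (rule sum.reindex_cong[OF _ refl refl]) (fastforce simp: inj_on_def set_eq_iff)
  also have "\<dots> = wedge (contract x \<alpha>) \<beta> xs"
    unfolding wedge_def
    by (rule sum.cong[OF refl], subst inversions_insert_0) (simp add: nths_shift contract_def)
  finally show ?thesis by simp
qed

lemma contract_wedge: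
  "contract x (wedge \<alpha> \<beta>) = wedge (contract x \<alpha>) \<beta> + wedge (grade_inv \<alpha>) (contract x \<beta>)"
  by (simp add: contract_def[of x "wedge \<alpha> \<beta>"] wedge_Cons plus_fun_def)

lemma wedge_linear:
  "wedge (\<alpha> + \<alpha>') \<beta> = wedge \<alpha> \<beta> + wedge \<alpha>' \<beta>"
  "wedge \<alpha> (\<beta> + \<beta>') = wedge \<alpha> \<beta> + wedge \<alpha> \<beta>'"
  "wedge (scale_form c \<alpha>) \<beta> = scale_form c (wedge \<alpha> \<beta>)"
  "wedge \<alpha> (scale_form c \<beta>) = scale_form c (wedge \<alpha> \<beta>)"
  "wedge 0 \<beta> = 0" "wedge \<alpha> 0 = 0"
  "wedge (- \<alpha>) \<beta> = - wedge \<alpha> \<beta>"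
  "wedge \<alpha> (- \<beta>) = - wedge \<alpha> \<beta>"
  "wedge \<alpha> (\<beta> - \<beta>') = wedge \<alpha> \<beta> - wedge \<alpha> \<beta>'"
  by (auto simp: fun_eq_iff wedge_def scale_form_def sum.distrib sum_distrib_left sum_negf sum_subtractf algebra_simps)

lemma wedge_diff_left: "wedge (\<alpha> - \<alpha>') \<beta> = wedge \<alpha> \<beta> - wedge \<alpha>' \<beta>"
  by (simp add: fun_eq_iff wedge_def sum_subtractf algebra_simps)

lemma contract_linear [simp]:
  "contract x (\<alpha> + \<beta>) = contract x \<alpha> + contract x \<beta>"
  "contract x (\<alpha> - \<beta>) = contract x \<alpha> - contract x \<beta>"
  "contract x (scale_form c \<alpha>) = scale_form c (contract x \<alpha>)"
  "contract x 0 = 0" "contract x (- \<alpha>) = - contract x \<alpha>"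
  by (auto simp: fun_eq_iff contract_def scale_form_def)

lemma grade_inv_linear [simp]:
  "grade_inv (\<alpha> + \<beta>) = grade_inv \<alpha> + grade_inv \<beta>"
  "grade_inv (scale_form c \<alpha>) = scale_form c (grade_inv \<alpha>)"
  "grade_inv 0 = 0" "grade_inv (- \<alpha>) = - grade_inv \<alpha>"
  by (auto simp: fun_eq_iff grade_inv_def scale_form_def algebra_simps)

lemma grade_inv_grade_inv [simp]: "grade_inv (grade_inv \<alpha>) = \<alpha>"
  by (simp add: fun_eq_iff grade_inv_def flip: power_mult_distrib)

lemma contract_grade_inv: "contract x (grade_inv \<alpha>) = - grade_inv (contract x \<alpha>)"
  by (simp add: fun_eq_iff grade_inv_def contract_def)

text \<open>Case distinction on the argument list, in terms of forms.\<close>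
lemma form_eqI: "\<omega> [] = \<eta> [] \<Longrightarrow> (\<And>x. contract x \<omega> = contract x \<eta>) \<Longrightarrow> \<omega> = \<eta>"
proof
  fix xs assume "\<omega> [] = \<eta> []" "\<And>x. contract x \<omega> = contract x \<eta>"
  then show "\<omega> xs = \<eta> xs" by (cases xs) (auto simp: contract_def fun_eq_iff)
qed

lemma grade_inv_wedge: "grade_inv (wedge \<alpha> \<beta>) = wedge (grade_inv \<alpha>) (grade_inv \<beta>)"
proof
  fix xs show "grade_inv (wedge \<alpha> \<beta>) xs = wedge (grade_inv \<alpha>) (grade_inv \<beta>) xs"
  proof (induction xs arbitrary: \<alpha> \<beta>)
    case (Cons x xs)
    have "grade_inv (wedge \<alpha> \<beta>) (x # xs) = - grade_inv (contract x (wedge \<alpha> \<beta>)) xs"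
      by (simp add: grade_inv_def contract_def)
    then show ?case
      by (simp add: contract_wedge Cons.IH wedge_Cons contract_grade_inv wedge_linear)
  qed (simp add: wedge_Nil grade_inv_def)
qed

lemma wedge_assoc: "wedge (wedge \<alpha> \<beta>) \<gamma> = wedge \<alpha> (wedge \<beta> \<gamma>)"
proof
  fix xs show "wedge (wedge \<alpha> \<beta>) \<gamma> xs = wedge \<alpha> (wedge \<beta> \<gamma>) xs"
    by (induction xs arbitrary: \<alpha> \<beta> \<gamma>)
      (simp_all add: wedge_Nil wedge_Cons contract_wedge wedge_linear grade_inv_wedge)
qed

lemma unit_form_simps [simp]:
  "unit_form [] = 1" "contract x unit_form = 0" "grade_inv unit_form = unit_form"
  by (auto simp: unit_form_def contract_def grade_inv_def fun_eq_iff)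

lemma wedge_unit_left [simp]: "wedge unit_form \<omega> = \<omega>"
proof
  fix xs show "wedge unit_form \<omega> xs = \<omega> xs"
    by (induction xs arbitrary: \<omega>) (simp_all add: wedge_Nil wedge_Cons wedge_linear, simp add: contract_def)
qed

lemma wedge_unit_right [simp]: "wedge \<omega> unit_form = \<omega>"
proof
  fix xs show "wedge \<omega> unit_form xs = \<omega> xs"
    by (induction xs arbitrary: \<omega>) (simp_all add: wedge_Nil wedge_Cons wedge_linear, simp add: contract_def)
qed

lemma one_form_simps [simp]:
  "one_form \<alpha> [] = 0" "one_form \<alpha> [x] = \<alpha> x"
  "contract x (one_form \<alpha>) = scale_form (\<alpha> x) unit_form"
  "grade_inv (one_form \<alpha>) = - one_form \<alpha>"
  by (auto simp: one_form_def contract_def fun_eq_iff scale_form_def unit_form_def grade_inv_def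
      length_Suc_conv)

lemma contract_one_form_wedge:
  "contract x (wedge (one_form \<alpha>) \<omega>) = scale_form (\<alpha> x) \<omega> - wedge (one_form \<alpha>) (contract x \<omega>)"
  by (simp add: contract_wedge wedge_linear)

lemma one_form_anticommute:
  "wedge (one_form \<alpha>) (wedge (one_form \<beta>) \<omega>) = - wedge (one_form \<beta>) (wedge (one_form \<alpha>) \<omega>)"
proof
  fix xs show "wedge (one_form \<alpha>) (wedge (one_form \<beta>) \<omega>) xs =
      (- wedge (one_form \<beta>) (wedge (one_form \<alpha>) \<omega>)) xs"
  proof (induction xs arbitrary: \<omega>)
    case (Cons x xs)
    have "contract x (wedge (one_form \<alpha>) (wedge (one_form \<beta>) \<omega>)) xs =
        contract x (- wedge (one_form \<beta>) (wedge (one_form \<alpha>) \<omega>)) xs"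
      using Cons.IH[of "contract x \<omega>"]
      by (simp add: contract_one_form_wedge wedge_linear)
    then show ?case by (simp add: contract_def)
  qed (simp add: wedge_Nil)
qed

lemma wedge_list_simps [simp]:
  "wedge_list [] = unit_form"
  "wedge_list (\<alpha> # \<alpha>s) = wedge (one_form \<alpha>) (wedge_list \<alpha>s)"
  by (simp_all add: wedge_list_def)

lemma wedge_list_append: "wedge_list (\<alpha>s @ \<beta>s) = wedge (wedge_list \<alpha>s) (wedge_list \<beta>s)"
  by (induction \<alpha>s) (simp_all add: wedge_assoc)

definition alternating :: "'a form \<Rightarrow> bool" where
  "alternating \<omega> \<longleftrightarrow> (\<forall>us x y vs. \<omega> (us @ x # y # vs) = - \<omega> (us @ y # x # vs))"

lemma alternatingD: "alternating \<omega> \<Longrightarrow> \<omega> (us @ x # y # vs) = - \<omega> (us @ y # x # vs)"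
  unfolding alternating_def by blast

lemma alternating_swap_first: "alternating \<omega> \<Longrightarrow> \<omega> (x # y # vs) = - \<omega> (y # x # vs)"
  using alternatingD[of \<omega> "[]" x y vs] by (simp only: append_Nil)

lemma alternating_contract: "alternating \<omega> \<Longrightarrow> alternating (contract x \<omega>)"
  unfolding alternating_def contract_def by (metis append_Cons)

lemma alternating_grade_inv: "alternating \<omega> \<Longrightarrow> alternating (grade_inv \<omega>)"
  unfolding grade_inv_def alternating_def by (metis length_append length_Cons mult_minus_right)

lemma alternating_wedge:
  assumes "alternating \<alpha>" "alternating \<beta>"
  shows "alternating (wedge \<alpha> \<beta>)"
proof -
  have "wedge \<alpha> \<beta> (us @ x # y # vs) = - wedge \<alpha> \<beta> (us @ y # x # vs)" for us x y vs
    using assms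
  proof (induction us arbitrary: \<alpha> \<beta>)
    case Nil
    \<comment> \<open>Exchanging \<open>x\<close> and \<open>y\<close> in the twofold contraction of the product exchanges its two mixed terms
      up to sign; for the other two terms the sign comes from the hypotheses.\<close>
    have "contract y (contract x \<omega>) = - contract x (contract y \<omega>)"
      if "alternating \<omega>" for \<omega> :: "'a form"
      unfolding contract_def fun_Compl_def by (rule ext, rule alternating_swap_first[OF that])
    then show ?case using Nil
      by (simp add: wedge_Cons contract_grade_inv wedge_linear)
  next
    case (Cons u us)
    then show ?case
      by (simp add: wedge_Cons alternating_contract alternating_grade_inv)
  qed
  then show ?thesis unfolding alternating_def by blast
qed

lemma alternating_one_form [simp]: "alternating (one_form \<alpha>)"
  by (simp add: alternating_def one_form_def)

lemma alternating_unit_form [simp]: "alternating unit_form"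
  by (simp add: alternating_def unit_form_def)

lemma alternating_wedge_list [simp]: "alternating (wedge_list \<alpha>s)"
  by (induction \<alpha>s) (simp_all add: alternating_wedge)

lemma alternating_not_distinct:
  assumes "alternating \<omega>" "\<not> distinct xs"
  shows "\<omega> xs = 0"
proof -
  have "\<omega> (us @ x # ys @ x # vs) = 0" for us x ys vs
  proof (induction ys arbitrary: us)
    case Nil
    then show ?case using alternatingD[OF assms(1), of us x x vs] by simp
  next
    case (Cons y ys)
    then show ?case using alternatingD[OF assms(1), of us x y "ys @ x # vs"] Cons[of "us @ [y]"] by simp
  qed
  moreover obtain us ys vs x where "xs = us @ [x] @ ys @ [x] @ vs"
    using not_distinct_decomp[OF assms(2)] by blast
  ultimately show ?thesis by simp
qed

section \<open>The Chevalley--Eilenberg differential as an antiderivation\<close>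

text \<open>Since a transposition of later arguments happens inside a contraction, only the first two
arguments have to be inspected.\<close>
lemma alternatingI:
  assumes "\<And>x y vs. \<omega> (x # y # vs) = - \<omega> (y # x # vs)"
    and "\<And>x. alternating (contract x \<omega>)"
  shows "alternating \<omega>"
  unfolding alternating_def
proof (intro allI)
  fix us x y vs show "\<omega> (us @ x # y # vs) = - \<omega> (us @ y # x # vs)"
  proof (cases us)
    case (Cons u us')
    then show ?thesis
      using alternatingD[OF assms(2)[of u], of us' x y vs] by (simp add: contract_def)
  qed (simp add: assms(1)[of x y])
qed

context complex_lie_algebra
begin

lemma bracket_add_left: "bracket (x + y) z = bracket x z + bracket y z"
  and bracket_scale_left: "bracket (scale c x) z = scale c (bracket x z)"
  using bracket_linear_left[of z] by (auto simp: Vector_Spaces.linear_iff)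

lemma bracket_add_right: "bracket z (x + y) = bracket z x + bracket z y"
  and bracket_scale_right: "bracket z (scale c x) = scale c (bracket z x)"
  using bracket_linear_right[of z] by (auto simp: Vector_Spaces.linear_iff)

lemma bracket_antisym: "bracket x y = - bracket y x"
proof -
  have "bracket (x + y) (x + y) = 0" by (rule bracket_self)
  then have "bracket x y + bracket y x = 0"
    unfolding bracket_add_left bracket_add_right by (simp add: bracket_self add.commute)
  then show ?thesis
    by (simp add: eq_neg_iff_add_eq_0)
qed

lemma jacobi_derivation: "bracket x (bracket y z) = bracket (bracket x y) z + bracket y (bracket x z)"
proof -
  have "bracket y (bracket z x) = - bracket y (bracket x z)"
    using bracket_antisym[of z x] bracket_scale_right[of y "-1" "bracket x z"] by simp
  moreover have "bracket z (bracket x y) = - bracket (bracket x y) z"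
    by (rule bracket_antisym)
  ultimately show ?thesis
    using jacobi[of x y z] by (simp add: algebra_simps add_eq_0_iff)
qed

text \<open>The coadjoint action of \<open>x\<close>, extended to forms as a derivation; it is the Lie derivative of left
invariant forms.\<close>
definition lie_derivative :: "'a \<Rightarrow> 'a form \<Rightarrow> 'a form" where
  "lie_derivative x \<omega> xs = - (\<Sum>i<length xs. \<omega> (xs[i := bracket x (xs ! i)]))"

lemma lie_Nil [simp]: "lie_derivative x \<omega> [] = 0"
  by (simp add: lie_derivative_def)

lemma contract_lie: "contract y (lie_derivative x \<omega>) = lie_derivative x (contract y \<omega>) - contract (bracket x y) \<omega>"
  by (simp add: fun_eq_iff contract_def lie_derivative_def sum.lessThan_Suc_shift del: sum.lessThan_Suc)

lemma lie_linear:
  "lie_derivative x (\<alpha> + \<beta>) = lie_derivative x \<alpha> + lie_derivative x \<beta>"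
  "lie_derivative x (\<alpha> - \<beta>) = lie_derivative x \<alpha> - lie_derivative x \<beta>"
  "lie_derivative x (scale_form c \<alpha>) = scale_form c (lie_derivative x \<alpha>)"
  "lie_derivative x 0 = 0" "lie_derivative x (- \<alpha>) = - lie_derivative x \<alpha>"
  by (auto simp: fun_eq_iff lie_derivative_def scale_form_def sum.distrib sum_distrib_left sum_negf sum_subtractf)

lemma lie_grade_inv: "lie_derivative x (grade_inv \<omega>) = grade_inv (lie_derivative x \<omega>)"
  by (simp add: fun_eq_iff lie_derivative_def grade_inv_def sum_distrib_left)

lemma lie_wedge: "lie_derivative x (wedge \<alpha> \<beta>) = wedge (lie_derivative x \<alpha>) \<beta> + wedge \<alpha> (lie_derivative x \<beta>)"
proof
  fix xs show "lie_derivative x (wedge \<alpha> \<beta>) xs = (wedge (lie_derivative x \<alpha>) \<beta> + wedge \<alpha> (lie_derivative x \<beta>)) xs"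
  proof (induction xs arbitrary: \<alpha> \<beta>)
    case (Cons y xs)
    have "contract y (lie_derivative x (wedge \<alpha> \<beta>)) xs = contract y (wedge (lie_derivative x \<alpha>) \<beta> + wedge \<alpha> (lie_derivative x \<beta>)) xs"
      by (simp add: contract_lie contract_wedge lie_linear wedge_linear Cons.IH lie_grade_inv wedge_diff_left)
    then show ?case by (simp add: contract_def)
  qed (simp add: wedge_Nil)
qed

lemma lie_unit_form [simp]: "lie_derivative x unit_form = 0"
  by (simp add: fun_eq_iff lie_derivative_def unit_form_def)

lemma lie_one_form [simp]: "lie_derivative x (one_form \<alpha>) = one_form (\<lambda>y. - \<alpha> (bracket x y))"
  by (auto simp: fun_eq_iff lie_derivative_def one_form_def length_Suc_conv)

text \<open>On alternating forms the bracket may be moved to the front, which is the shape of the summands of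
the Chevalley--Eilenberg differential with lower index 0.\<close>
lemma lie_alternating:
  assumes "alternating \<omega>"
  shows "lie_derivative x \<omega> xs = - (\<Sum>j<length xs. (-1) ^ j * \<omega> (bracket x (xs ! j) # nths xs (- {j})))"
  using assms
proof (induction xs arbitrary: \<omega>)
  case (Cons y ys)
  have shift: "{j. Suc j \<in> - {Suc k}} = - {k}" "{j. Suc j \<in> - {0::nat}} = UNIV"
    "{j. j \<noteq> k} = - {k}" for k :: nat
    by auto
  have "lie_derivative x \<omega> (y # ys) = lie_derivative x (contract y \<omega>) ys - \<omega> (bracket x y # ys)"
    using fun_cong[OF contract_lie[of y x \<omega>], of ys] by (simp add: contract_def)
  also have "\<dots> = - \<omega> (bracket x y # ys)
      - (\<Sum>j<length ys. (-1) ^ j * \<omega> (y # bracket x (ys ! j) # nths ys (- {j})))"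
    using Cons.IH[OF alternating_contract[OF Cons.prems]] by (simp add: contract_def)
  also have "\<dots> = - \<omega> (bracket x y # ys)
      + (\<Sum>j<length ys. (-1) ^ j * \<omega> (bracket x (ys ! j) # y # nths ys (- {j})))"
    by (subst alternating_swap_first[OF Cons.prems]) (simp add: sum_negf)
  finally show ?case
    by (simp add: sum.lessThan_Suc_shift nths_Cons shift nths_all sum_negf del: sum.lessThan_Suc)
qed simp

lemma CE_d_Nil [simp]: "d \<omega> [] = 0"
  by (simp add: CE_d_def)

text \<open>Cartan's formula.  In the double sum for \<open>d\<close> at \<open>x # xs\<close>, the pairs that contain position 0 give the Lie
derivative, the others the differential of the contraction.\<close>
lemma contract_d:
  assumes "alternating \<omega>"
  shows "contract x (d \<omega>) = lie_derivative x \<omega> - d (contract x \<omega>)"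
proof
  fix xs
  let ?T = "\<lambda>i j. (-1) ^ (i + j) * \<omega> (bracket ((x # xs) ! i) ((x # xs) ! j) # nths (x # xs) (- {i, j}))"
  have shift: "{j. Suc j \<in> - {Suc k, Suc l}} = - {k, l}" "{j. Suc j \<in> - {0, Suc l}} = - {l}"
    "{j. j \<noteq> k \<and> j \<noteq> l} = - {k, l}" "{j. j \<noteq> k} = - {k}" for k l :: nat
    by auto
  have "contract x (d \<omega>) xs = (\<Sum>j<Suc (length xs). \<Sum>i<j. ?T i j)"
    by (simp add: contract_def CE_d_def)
  also have "\<dots> = (\<Sum>j<length xs. ?T 0 (Suc j) + (\<Sum>i<j. ?T (Suc i) (Suc j)))"
    by (simp only: sum.lessThan_Suc_shift) simp
  also have "\<dots> = (\<Sum>j<length xs. ?T 0 (Suc j)) + (\<Sum>j<length xs. \<Sum>i<j. ?T (Suc i) (Suc j))"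
    by (rule sum.distrib)
  also have "(\<Sum>j<length xs. ?T 0 (Suc j)) = lie_derivative x \<omega> xs"
    by (simp add: lie_alternating[OF assms] nths_Cons shift sum_negf)
  also have "(\<Sum>j<length xs. \<Sum>i<j. ?T (Suc i) (Suc j)) = - d (contract x \<omega>) xs"
  proof -
    have "?T (Suc i) (Suc j) =
        - ((-1) ^ (i + j) * contract x \<omega> (bracket (xs ! i) (xs ! j) # nths xs (- {i, j})))" for i j
      using alternating_swap_first[OF assms, of "bracket (xs ! i) (xs ! j)" x "nths xs (- {i, j})"]
      by (simp add: nths_Cons shift contract_def)
    then show ?thesis
      by (simp add: CE_d_def sum_negf)
  qed
  finally show "contract x (d \<omega>) xs = (lie_derivative x \<omega> - d (contract x \<omega>)) xs"
    by simp
qed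

lemma d_linear:
  "d (\<alpha> + \<beta>) = d \<alpha> + d \<beta>"
  "d (scale_form c \<alpha>) = scale_form c (d \<alpha>)"
  "d 0 = 0" "d (- \<alpha>) = - d \<alpha>"
  by (auto simp: fun_eq_iff CE_d_def scale_form_def sum.distrib sum_distrib_left sum_negf algebra_simps)

lemma d_grade_inv:
  assumes "alternating \<omega>"
  shows "d (grade_inv \<omega>) = - grade_inv (d \<omega>)"
proof
  fix xs show "d (grade_inv \<omega>) xs = (- grade_inv (d \<omega>)) xs"
    using assms
  proof (induction xs arbitrary: \<omega>)
    case (Cons x xs)
    have "contract x (d (grade_inv \<omega>)) xs = contract x (- grade_inv (d \<omega>)) xs"
      using Cons.IH[OF alternating_contract[OF Cons.prems], of x]
      by (simp add: contract_d Cons.prems alternating_grade_inv contract_grade_inv lie_grade_inv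
          d_linear) (simp add: grade_inv_def algebra_simps)
    then show ?case by (simp add: contract_def)
  qed (simp add: grade_inv_def)
qed

text \<open>By Cartan's formula both sides satisfy the same recursion under contraction, as the Lie
derivative is a derivation.\<close>
lemma d_wedge:
  assumes "alternating \<alpha>" "alternating \<beta>"
  shows "d (wedge \<alpha> \<beta>) = wedge (d \<alpha>) \<beta> + wedge (grade_inv \<alpha>) (d \<beta>)"
proof
  fix xs show "d (wedge \<alpha> \<beta>) xs = (wedge (d \<alpha>) \<beta> + wedge (grade_inv \<alpha>) (d \<beta>)) xs"
    using assms
  proof (induction xs arbitrary: \<alpha> \<beta>)
    case (Cons x xs)
    note alt = Cons.prems alternating_contract[OF Cons.prems(1), of x]
      alternating_contract[OF Cons.prems(2), of x] alternating_grade_inv[OF Cons.prems(1)]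
    have "contract x (d (wedge \<alpha> \<beta>)) xs = contract x (wedge (d \<alpha>) \<beta> + wedge (grade_inv \<alpha>) (d \<beta>)) xs"
      by (simp add: contract_d alternating_wedge alt contract_wedge lie_wedge d_linear Cons.IH
          wedge_linear wedge_diff_left contract_grade_inv d_grade_inv
          wedge_linear(7)[unfolded fun_Compl_def])
    then show ?case by (simp add: contract_def)
  qed (simp add: wedge_Nil)
qed

lemma d_unit_form [simp]: "d unit_form = 0"
  by (simp add: fun_eq_iff CE_d_def unit_form_def)

lemma contract_d_one_form: "contract x (d (one_form \<alpha>)) = one_form (\<lambda>y. - \<alpha> (bracket x y))"
  by (simp add: contract_d d_linear)

lemma additive_minus:
  fixes \<alpha> :: "'a \<Rightarrow> complex"
  assumes "\<And>x y. \<alpha> (x + y) = \<alpha> x + \<alpha> y"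
  shows "\<alpha> 0 = 0" "\<alpha> (- x) = - \<alpha> x"
  using assms[of 0 0] assms[of x "- x"] by (auto simp: add_eq_0_iff)

lemma alternating_d_one_form:
  assumes "\<And>x y. \<alpha> (x + y) = \<alpha> x + \<alpha> y"
  shows "alternating (d (one_form \<alpha>))"
proof (rule alternatingI)
  fix x y vs
  have eq: "d (one_form \<alpha>) (x # vs) = one_form (\<lambda>y. - \<alpha> (bracket x y)) vs" for x vs
    using fun_cong[OF contract_d_one_form[of x \<alpha>], of vs] by (simp add: contract_def)
  show "d (one_form \<alpha>) (x # y # vs) = - d (one_form \<alpha>) (y # x # vs)"
    unfolding eq using bracket_antisym[of x y]
    by (simp add: one_form_def additive_minus[of \<alpha>, OF assms])
qed (simp add: contract_d_one_form)

text \<open>Contracting twice leaves a one-form whose coefficient is the Jacobi expression.\<close>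
lemma d_d_one_form:
  assumes "\<And>x y. \<alpha> (x + y) = \<alpha> x + \<alpha> y"
  shows "d (d (one_form \<alpha>)) = 0"
proof (rule form_eqI)
  fix x
  have "contract y (contract x (d (d (one_form \<alpha>)))) = 0" for y
    by (simp add: contract_d alternating_d_one_form[of \<alpha>, OF assms] contract_d_one_form contract_lie)
      (auto simp: one_form_def fun_eq_iff jacobi_derivation[of x y] assms)
  then show "contract x (d (d (one_form \<alpha>))) = contract x 0"
    by - (rule form_eqI, simp_all, simp add: contract_def CE_d_def[of _ _ "[x]"])
qed simp

end

section \<open>Forms of pure bidegree\<close>

text \<open>From here on identities between forms are mostly proved without evaluating them, so the pointwise
rules are used only on demand.\<close>
lemmas form_apply = plus_fun_apply zero_fun_apply uminus_apply minus_apply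

declare form_apply [simp del]

lemma wedge_sum_left: "wedge (\<Sum>i\<in>A. f i) \<omega> = (\<Sum>i\<in>A. wedge (f i) \<omega>)"
  by (induction A rule: infinite_finite_induct) (simp_all add: wedge_linear)

lemma wedge_sum_right: "wedge \<omega> (\<Sum>i\<in>A. f i) = (\<Sum>i\<in>A. wedge \<omega> (f i))"
  by (induction A rule: infinite_finite_induct) (simp_all add: wedge_linear)

lemma contract_sum: "contract x (\<Sum>i\<in>A. f i) = (\<Sum>i\<in>A. contract x (f i))"
  by (induction A rule: infinite_finite_induct) simp_all

lemma sum_form_apply: "(\<Sum>i\<in>A. f i) xs = (\<Sum>i\<in>A. (f i :: 'a form) xs)"
  by (induction A rule: infinite_finite_induct) (simp_all add: form_apply)

lemma length_nths_Compl: "length (nths xs I) + length (nths xs (- I)) = length xs"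
proof -
  have "{..<length xs} = {i. i < length xs \<and> i \<in> I} \<union> {i. i < length xs \<and> i \<in> - I}"
    by auto
  then have "card {..<length xs} = card ({i. i < length xs \<and> i \<in> I} \<union> {i. i < length xs \<and> i \<in> - I})"
    by simp
  then show ?thesis
    by (subst (asm) card_Un_disjoint) (auto simp: length_nths)
qed

lemma wedge_homogeneous:
  assumes "\<And>xs. length xs \<noteq> k \<Longrightarrow> \<alpha> xs = 0" "\<And>xs. length xs \<noteq> l \<Longrightarrow> \<beta> xs = 0"
    "length xs \<noteq> k + l"
  shows "wedge \<alpha> \<beta> xs = 0"
  unfolding wedge_def
proof (rule sum.neutral, rule ballI)
  fix I
  have "length (nths xs I) \<noteq> k \<or> length (nths xs (- I)) \<noteq> l"
    using length_nths_Compl[of xs I] assms(3) by auto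
  then show "(- 1) ^ card {(i, j). i \<in> I \<and> j < i \<and> j \<notin> I} * \<alpha> (nths xs I) * \<beta> (nths xs (- I)) = 0"
    using assms(1,2) by auto
qed

lemma wedge_list_homogeneous: "length xs \<noteq> length \<alpha>s \<Longrightarrow> wedge_list \<alpha>s xs = 0"
proof (induction \<alpha>s arbitrary: xs)
  case (Cons \<alpha> \<alpha>s)
  then show ?case
    by (simp, intro wedge_homogeneous[of 1 _ "length \<alpha>s"]) (auto simp: one_form_def)
qed (auto simp: unit_form_def)

context complex_lie_algebra
begin

lemma dual_C_iff:
  "\<alpha> \<in> dual_C \<longleftrightarrow> (\<forall>x y. \<alpha> (x + y) = \<alpha> x + \<alpha> y) \<and>
     (\<forall>r x. \<alpha> (scale (of_real r) x) = of_real r * \<alpha> x)"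
proof -
  have "vector_space (\<lambda>r::real. scale (of_real r))"
    by standard (auto simp: scale_right_distrib scale_left_distrib)
  moreover have "vector_space ((*\<^sub>R) :: real \<Rightarrow> complex \<Rightarrow> complex)"
    by standard (auto simp: algebra_simps)
  ultimately show ?thesis
    unfolding dual_C_def by (auto simp: Vector_Spaces.linear_iff scaleR_conv_of_real)
qed

lemma scale_complex: "scale c x = scale (of_real (Re c)) x + scale (of_real (Im c)) (J x)"
proof -
  have "c = of_real (Re c) + of_real (Im c) * \<i>"
    by (simp add: complex_eq_iff)
  then show ?thesis
    unfolding J_def by (metis scale_left_distrib scale_scale)
qed

lemma dual_10_iff:
  "\<alpha> \<in> dual_10 \<longleftrightarrow> (\<forall>x y. \<alpha> (x + y) = \<alpha> x + \<alpha> y) \<and> (\<forall>c x. \<alpha> (scale c x) = c * \<alpha> x)"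
proof
  assume a: "\<alpha> \<in> dual_10"
  have "\<alpha> (scale c x) = c * \<alpha> x" for c x
  proof -
    have "\<alpha> (scale c x) = (of_real (Re c) + of_real (Im c) * \<i>) * \<alpha> x"
      using a by (subst scale_complex) (simp add: dual_10_def dual_C_iff algebra_simps)
    also have "of_real (Re c) + of_real (Im c) * \<i> = c"
      by (simp add: complex_eq_iff)
    finally show ?thesis .
  qed
  with a show "(\<forall>x y. \<alpha> (x + y) = \<alpha> x + \<alpha> y) \<and> (\<forall>c x. \<alpha> (scale c x) = c * \<alpha> x)"
    by (auto simp: dual_10_def dual_C_iff)
qed (auto simp: dual_10_def dual_C_iff J_def)

lemma dual_01_iff:
  "\<alpha> \<in> dual_01 \<longleftrightarrow> (\<forall>x y. \<alpha> (x + y) = \<alpha> x + \<alpha> y) \<and> (\<forall>c x. \<alpha> (scale c x) = cnj c * \<alpha> x)"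
proof
  assume a: "\<alpha> \<in> dual_01"
  have "\<alpha> (scale c x) = cnj c * \<alpha> x" for c x
  proof -
    have "\<alpha> (scale c x) = (of_real (Re c) - of_real (Im c) * \<i>) * \<alpha> x"
      using a by (subst scale_complex) (simp add: dual_01_def dual_C_iff algebra_simps)
    also have "of_real (Re c) - of_real (Im c) * \<i> = cnj c"
      by (simp add: complex_eq_iff)
    finally show ?thesis .
  qed
  with a show "(\<forall>x y. \<alpha> (x + y) = \<alpha> x + \<alpha> y) \<and> (\<forall>c x. \<alpha> (scale c x) = cnj c * \<alpha> x)"
    by (auto simp: dual_01_def dual_C_iff)
qed (auto simp: dual_01_def dual_C_iff J_def)

lemma dual_01_cnj: "\<alpha> \<in> dual_10 \<Longrightarrow> (\<lambda>x. cnj (\<alpha> x)) \<in> dual_01"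
  by (simp add: dual_01_iff dual_10_iff)

definition coord :: "'a \<Rightarrow> 'a \<Rightarrow> complex" where
  "coord b x = representation Basis x b"

lemma coord_dual_10: "coord b \<in> dual_10"
  unfolding dual_10_iff coord_def
  by (auto simp: representation_add representation_scale independent_Basis span_Basis)

lemma sum_coord: "(\<Sum>b\<in>Basis. scale (coord b x) b) = x"
  unfolding coord_def
  by (rule sum_representation_eq) (auto simp: independent_Basis span_Basis finite_Basis)

lemma coord_Basis: "b \<in> Basis \<Longrightarrow> c \<in> Basis \<Longrightarrow> coord b c = (if b = c then 1 else 0)"
  unfolding coord_def by (simp add: representation_basis[OF independent_Basis])

lemma additive_sum:
  fixes \<alpha> :: "'a \<Rightarrow> complex"
  assumes "\<And>x y. \<alpha> (x + y) = \<alpha> x + \<alpha> y"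
  shows "\<alpha> (\<Sum>i\<in>A. f i) = (\<Sum>i\<in>A. \<alpha> (f i))"
  by (induction A rule: infinite_finite_induct) (simp_all add: assms additive_minus[of \<alpha>, OF assms])

lemma dual_10_expand: "\<alpha> \<in> dual_10 \<Longrightarrow> \<alpha> x = (\<Sum>b\<in>Basis. coord b x * \<alpha> b)"
  by (subst (1) sum_coord[of x, symmetric], subst additive_sum) (auto simp: dual_10_iff)

lemma dual_01_expand: "\<alpha> \<in> dual_01 \<Longrightarrow> \<alpha> x = (\<Sum>b\<in>Basis. cnj (coord b x) * \<alpha> b)"
  by (subst (1) sum_coord[of x, symmetric], subst additive_sum) (auto simp: dual_01_iff)

lemma dual_bracket:
  "\<alpha> \<in> dual_10 \<Longrightarrow> (\<lambda>y. - \<alpha> (bracket x y)) \<in> dual_10"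
  "\<beta> \<in> dual_01 \<Longrightarrow> (\<lambda>y. - \<beta> (bracket x y)) \<in> dual_01"
  by (auto simp: dual_10_iff dual_01_iff bracket_add_right bracket_scale_right)

text \<open>The formula \<open>2 d = \<Sum> e\<^sub>b \<and> L\<^sub>b\<close> on one-forms, where \<open>L\<^sub>b\<close> is the Lie derivative in the direction of \<open>b\<close> and
\<open>e\<^sub>b\<close> is the dual basis.  The hypothesis covers functionals of both types: \<open>\<epsilon> b\<close> is
\<open>coord b\<close> for complex linear and its conjugate for antilinear \<open>\<alpha>\<close>.\<close>
lemma d_one_form_expand:
  assumes add: "\<And>x y. \<alpha> (x + y) = \<alpha> x + \<alpha> y"
    and expand: "\<And>x y. \<alpha> (bracket x y) = (\<Sum>b\<in>Basis. \<epsilon> b x * \<alpha> (bracket b y))"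
  shows "d (one_form \<alpha>) = scale_form (1 / 2)
     (\<Sum>b\<in>Basis. wedge (one_form (\<epsilon> b)) (one_form (\<lambda>y. - \<alpha> (bracket b y))))" (is "_ = ?r")
proof (rule form_eqI)
  show "d (one_form \<alpha>) [] = ?r []"
    by (simp add: scale_form_def sum_form_apply wedge_Nil)
  fix x
  \<comment> \<open>The factor 1/2 accounts for the two orders in which a pair of arguments occurs.\<close>
  have "\<alpha> (bracket y x) = - \<alpha> (bracket x y)" for y
    using bracket_antisym[of y x] additive_minus[of \<alpha>, OF add] by simp
  then have "- \<alpha> (bracket x y) = (1 / 2) * (- \<alpha> (bracket x y) + \<alpha> (bracket y x))" for y
    by simp
  then have eq: "- \<alpha> (bracket x y) = (1 / 2) *
     (- (\<Sum>b\<in>Basis. \<epsilon> b x * \<alpha> (bracket b y)) + (\<Sum>b\<in>Basis. \<epsilon> b y * \<alpha> (bracket b x)))" for y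
    unfolding expand[of x y, symmetric] expand[of y x, symmetric] .
  have r: "contract x ?r = scale_form (1 / 2) (\<Sum>b\<in>Basis.
      scale_form (\<epsilon> b x) (one_form (\<lambda>y. - \<alpha> (bracket b y)))
      + scale_form (\<alpha> (bracket b x)) (one_form (\<epsilon> b)))"
    by (simp add: contract_sum contract_one_form_wedge wedge_linear form.scale_minus_left)
  show "contract x (d (one_form \<alpha>)) = contract x ?r"
  proof
    fix ys
    show "contract x (d (one_form \<alpha>)) ys = contract x ?r ys"
      unfolding r using eq[of "hd ys"]
      by (simp add: contract_d_one_form form_apply scale_form_def sum_form_apply one_form_def
          sum.distrib sum_negf mult.commute)
  qed
qed

lemma d_dual_10:
  "\<alpha> \<in> dual_10 \<Longrightarrow> d (one_form \<alpha>) = scale_form (1 / 2)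
     (\<Sum>b\<in>Basis. wedge (one_form (coord b)) (one_form (\<lambda>y. - \<alpha> (bracket b y))))"
proof (rule d_one_form_expand)
  fix x y assume "\<alpha> \<in> dual_10"
  then show "\<alpha> (bracket x y) = (\<Sum>b\<in>Basis. coord b x * \<alpha> (bracket b y))"
    using dual_10_expand[of "\<lambda>x. \<alpha> (bracket x y)" x]
    by (auto simp: dual_10_iff bracket_add_left bracket_scale_left)
qed (auto simp: dual_10_iff)

lemma d_dual_01:
  "\<alpha> \<in> dual_01 \<Longrightarrow> d (one_form \<alpha>) = scale_form (1 / 2)
     (\<Sum>b\<in>Basis. wedge (one_form (\<lambda>x. cnj (coord b x))) (one_form (\<lambda>y. - \<alpha> (bracket b y))))"
proof (rule d_one_form_expand)
  fix x y assume "\<alpha> \<in> dual_01"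
  then show "\<alpha> (bracket x y) = (\<Sum>b\<in>Basis. cnj (coord b x) * \<alpha> (bracket b y))"
    using dual_01_expand[of "\<lambda>x. \<alpha> (bracket x y)" x]
    by (auto simp: dual_01_iff bracket_add_left bracket_scale_left)
qed (auto simp: dual_01_iff)

lemma \<Lambda>_generator:
  "set \<alpha>s \<subseteq> dual_10 \<Longrightarrow> set \<beta>s \<subseteq> dual_01 \<Longrightarrow> p = int (length \<alpha>s) \<Longrightarrow> q = int (length \<beta>s)
    \<Longrightarrow> wedge_list (\<alpha>s @ \<beta>s) \<in> \<Lambda> p q"
  unfolding \<Lambda>_def by (rule form.span_base) blast

lemma \<Lambda>_subspace: "form.subspace (\<Lambda> p q)"
  unfolding \<Lambda>_def by (rule form.subspace_span)

lemmas \<Lambda>_zero = form.subspace_0[OF \<Lambda>_subspace]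
  and \<Lambda>_add = form.subspace_add[OF \<Lambda>_subspace]
  and \<Lambda>_diff = form.subspace_diff[OF \<Lambda>_subspace]
  and \<Lambda>_neg = form.subspace_neg[OF \<Lambda>_subspace]
  and \<Lambda>_scale = form.subspace_scale[OF \<Lambda>_subspace]
  and \<Lambda>_sum = form.subspace_sum[OF \<Lambda>_subspace]

lemma \<Lambda>_induct [consumes 1, case_names zero step]:
  assumes "\<omega> \<in> \<Lambda> p q" "P 0"
    and "\<And>c \<alpha>s \<beta>s \<omega>. \<lbrakk>set \<alpha>s \<subseteq> dual_10; set \<beta>s \<subseteq> dual_01; int (length \<alpha>s) = p; int (length \<beta>s) = q;
        \<omega> \<in> \<Lambda> p q; P \<omega>\<rbrakk> \<Longrightarrow> P (scale_form c (wedge_list (\<alpha>s @ \<beta>s)) + \<omega>)"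
  shows "P \<omega>"
proof -
  have "\<omega> \<in> \<Lambda> p q \<and> P \<omega>"
    using assms(1) unfolding \<Lambda>_def
  proof (induction rule: form.span_induct_alt)
    case base
    show ?case by (simp add: assms(2) form.span_zero)
  next
    case (step c x y)
    then obtain \<alpha>s \<beta>s where x: "x = wedge_list (\<alpha>s @ \<beta>s)" "int (length \<alpha>s) = p" "set \<alpha>s \<subseteq> dual_10"
        "int (length \<beta>s) = q" "set \<beta>s \<subseteq> dual_01"
      by blast
    then have "x \<in> \<Lambda> p q" by (auto intro: \<Lambda>_generator)
    then show ?case
      using step assms(3)[of \<alpha>s \<beta>s y c] x unfolding \<Lambda>_def[symmetric]
      by (auto intro: \<Lambda>_add \<Lambda>_scale)
  qed
  then show ?thesis by simp
qed

lemma \<Lambda>_negative: "\<omega> \<in> \<Lambda> p q \<Longrightarrow> p < 0 \<or> q < 0 \<Longrightarrow> \<omega> = 0"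
  by (induction rule: \<Lambda>_induct) auto

lemma \<Lambda>_alternating: "\<omega> \<in> \<Lambda> p q \<Longrightarrow> alternating \<omega>"
proof (induction rule: \<Lambda>_induct)
  case (step c \<alpha>s \<beta>s \<omega>)
  show ?case
    unfolding alternating_def
  proof (intro allI)
    fix us x y vs
    show "(scale_form c (wedge_list (\<alpha>s @ \<beta>s)) + \<omega>) (us @ x # y # vs) =
        - (scale_form c (wedge_list (\<alpha>s @ \<beta>s)) + \<omega>) (us @ y # x # vs)"
      using alternatingD[OF step(6), of us x y vs]
        alternatingD[OF alternating_wedge_list[of "\<alpha>s @ \<beta>s"], of us x y vs]
      by (simp add: scale_form_def form_apply)
  qed
qed (simp add: alternating_def form_apply)

lemma \<Lambda>_homogeneous: "\<omega> \<in> \<Lambda> p q \<Longrightarrow> int (length xs) \<noteq> p + q \<Longrightarrow> \<omega> xs = 0"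
proof (induction rule: \<Lambda>_induct)
  case (step c \<alpha>s \<beta>s \<omega>)
  then have "length xs \<noteq> length (\<alpha>s @ \<beta>s)" by auto
  with step show ?case
    using wedge_list_homogeneous[of xs "\<alpha>s @ \<beta>s"] by (simp add: scale_form_def form_apply)
qed (simp add: form_apply)

lemma wedge_10:
  assumes "\<alpha> \<in> dual_10" "\<omega> \<in> \<Lambda> p q"
  shows "wedge (one_form \<alpha>) \<omega> \<in> \<Lambda> (p + 1) q"
  using assms(2)
proof (induction rule: \<Lambda>_induct)
  case (step c \<alpha>s \<beta>s \<omega>)
  then have "wedge_list ((\<alpha> # \<alpha>s) @ \<beta>s) \<in> \<Lambda> (p + 1) q"
    using assms(1) by (intro \<Lambda>_generator) auto
  then show ?case
    using step by (auto simp: wedge_linear intro!: \<Lambda>_add \<Lambda>_scale)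
qed (simp add: wedge_linear \<Lambda>_zero)

lemma wedge_one_form_wedge_list:
  "wedge (one_form \<beta>) (wedge_list (\<alpha>s @ \<beta>s)) =
     scale_form ((-1) ^ length \<alpha>s) (wedge_list (\<alpha>s @ \<beta> # \<beta>s))"
proof (induction \<alpha>s)
  case (Cons \<alpha> \<alpha>s)
  then show ?case
    by (simp add: one_form_anticommute[of \<beta> \<alpha>] wedge_linear)
qed simp

lemma wedge_01:
  assumes "\<beta> \<in> dual_01" "\<omega> \<in> \<Lambda> p q"
  shows "wedge (one_form \<beta>) \<omega> \<in> \<Lambda> p (q + 1)"
  using assms(2)
proof (induction rule: \<Lambda>_induct)
  case (step c \<alpha>s \<beta>s \<omega>)
  then have "wedge_list (\<alpha>s @ \<beta> # \<beta>s) \<in> \<Lambda> p (q + 1)"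
    using assms(1) by (intro \<Lambda>_generator) auto
  then show ?case
    using step by (auto simp: wedge_linear wedge_one_form_wedge_list intro!: \<Lambda>_add \<Lambda>_scale)
qed (simp add: wedge_linear \<Lambda>_zero)

lemma unit_form_\<Lambda>: "unit_form \<in> \<Lambda> 0 0"
  using \<Lambda>_generator[of "[]" "[]"] by simp

lemma one_form_10: "\<alpha> \<in> dual_10 \<Longrightarrow> one_form \<alpha> \<in> \<Lambda> 1 0"
  using wedge_10[OF _ unit_form_\<Lambda>] by simp

lemma one_form_01: "\<beta> \<in> dual_01 \<Longrightarrow> one_form \<beta> \<in> \<Lambda> 0 1"
  using wedge_01[OF _ unit_form_\<Lambda>] by simp

text \<open>The differential of a complex linear functional has bidegree \<open>(2, 0)\<close>, as the bracket is complex bilinear.\<close>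
lemma wedge_d_10:
  assumes "\<alpha> \<in> dual_10" "\<omega> \<in> \<Lambda> p q"
  shows "wedge (d (one_form \<alpha>)) \<omega> \<in> \<Lambda> (p + 2) q"
  using wedge_10[OF coord_dual_10 wedge_10[OF dual_bracket(1)[OF assms(1)] assms(2)]]
  unfolding d_dual_10[OF assms(1)] wedge_linear wedge_sum_left wedge_assoc
  by (intro \<Lambda>_scale \<Lambda>_sum) (simp add: add.assoc)

lemma wedge_d_01:
  assumes "\<beta> \<in> dual_01" "\<omega> \<in> \<Lambda> p q"
  shows "wedge (d (one_form \<beta>)) \<omega> \<in> \<Lambda> p (q + 2)"
  using wedge_01[OF dual_01_cnj[OF coord_dual_10] wedge_01[OF dual_bracket(2)[OF assms(1)] assms(2)]]
  unfolding d_dual_01[OF assms(1)] wedge_linear wedge_sum_left wedge_assoc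
  by (intro \<Lambda>_scale \<Lambda>_sum) (simp add: add.assoc)

lemma d_one_form_10: "\<alpha> \<in> dual_10 \<Longrightarrow> d (one_form \<alpha>) \<in> \<Lambda> 2 0"
  using wedge_d_10[OF _ unit_form_\<Lambda>] by simp

lemma d_one_form_01: "\<beta> \<in> dual_01 \<Longrightarrow> d (one_form \<beta>) \<in> \<Lambda> 0 2"
  using wedge_d_01[OF _ unit_form_\<Lambda>] by simp

lemma d_one_form_wedge:
  "alternating \<omega> \<Longrightarrow>
    d (wedge (one_form \<alpha>) \<omega>) = wedge (d (one_form \<alpha>)) \<omega> - wedge (one_form \<alpha>) (d \<omega>)"
  by (simp add: d_wedge wedge_linear)

lemma d_wedge_list_10:
  "set \<alpha>s \<subseteq> dual_10 \<Longrightarrow> d (wedge_list \<alpha>s) \<in> \<Lambda> (int (length \<alpha>s) + 1) 0"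
proof (induction \<alpha>s)
  case (Cons \<alpha> \<alpha>s)
  have "wedge_list \<alpha>s \<in> \<Lambda> (int (length \<alpha>s)) 0"
    using \<Lambda>_generator[of \<alpha>s "[]"] Cons.prems by simp
  then have "wedge (d (one_form \<alpha>)) (wedge_list \<alpha>s) \<in> \<Lambda> (int (length \<alpha>s) + 2) 0"
    using Cons.prems by (intro wedge_d_10) auto
  moreover have "wedge (one_form \<alpha>) (d (wedge_list \<alpha>s)) \<in> \<Lambda> (int (length \<alpha>s) + 2) 0"
    using Cons wedge_10[of \<alpha> "d (wedge_list \<alpha>s)" "int (length \<alpha>s) + 1" 0] by (simp add: add.commute)
  ultimately show ?case
    by (simp add: d_one_form_wedge add.commute \<Lambda>_diff)
qed (simp add: \<Lambda>_zero)

lemma d_wedge_list_01: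
  "set \<beta>s \<subseteq> dual_01 \<Longrightarrow> d (wedge_list \<beta>s) \<in> \<Lambda> 0 (int (length \<beta>s) + 1)"
proof (induction \<beta>s)
  case (Cons \<beta> \<beta>s)
  have "wedge_list \<beta>s \<in> \<Lambda> 0 (int (length \<beta>s))"
    using \<Lambda>_generator[of "[]" \<beta>s] Cons.prems by simp
  then have "wedge (d (one_form \<beta>)) (wedge_list \<beta>s) \<in> \<Lambda> 0 (int (length \<beta>s) + 2)"
    using Cons.prems by (intro wedge_d_01) auto
  moreover have "wedge (one_form \<beta>) (d (wedge_list \<beta>s)) \<in> \<Lambda> 0 (int (length \<beta>s) + 2)"
    using Cons wedge_01[of \<beta> "d (wedge_list \<beta>s)" 0 "int (length \<beta>s) + 1"] by (simp add: add.commute)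
  ultimately show ?case
    by (simp add: d_one_form_wedge add.commute \<Lambda>_diff)
qed (simp add: \<Lambda>_zero)

lemma d_wedge_list_split:
  assumes "set \<alpha>s \<subseteq> dual_10" "set \<beta>s \<subseteq> dual_01"
  shows "\<exists>a\<in>\<Lambda> (int (length \<alpha>s) + 1) (int (length \<beta>s)). \<exists>b\<in>\<Lambda> (int (length \<alpha>s)) (int (length \<beta>s) + 1).
    d (wedge_list (\<alpha>s @ \<beta>s)) = a + b"
  using assms(1)
proof (induction \<alpha>s)
  case Nil
  show ?case
    using d_wedge_list_01[OF assms(2)] \<Lambda>_zero[of 1 "int (length \<beta>s)"] by force
next
  case (Cons \<alpha> \<alpha>s)
  let ?p = "int (length \<alpha>s)" and ?q = "int (length \<beta>s)"
  from Cons obtain a b where ab: "a \<in> \<Lambda> (?p + 1) ?q" "b \<in> \<Lambda> ?p (?q + 1)"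
    "d (wedge_list (\<alpha>s @ \<beta>s)) = a + b" by auto
  have "wedge_list (\<alpha>s @ \<beta>s) \<in> \<Lambda> ?p ?q"
    using \<Lambda>_generator[of \<alpha>s \<beta>s] Cons.prems assms(2) by simp
  then have "wedge (d (one_form \<alpha>)) (wedge_list (\<alpha>s @ \<beta>s)) \<in> \<Lambda> (?p + 1 + 1) ?q"
    using Cons.prems wedge_d_10[of \<alpha> "wedge_list (\<alpha>s @ \<beta>s)" ?p ?q] by (simp add: add.assoc)
  then have "wedge (d (one_form \<alpha>)) (wedge_list (\<alpha>s @ \<beta>s)) - wedge (one_form \<alpha>) a \<in> \<Lambda> (?p + 1 + 1) ?q"
    using wedge_10[OF _ ab(1), of \<alpha>] Cons.prems by (intro \<Lambda>_diff) auto
  moreover have "- wedge (one_form \<alpha>) b \<in> \<Lambda> (?p + 1) (?q + 1)"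
    using wedge_10[OF _ ab(2), of \<alpha>] Cons.prems by (intro \<Lambda>_neg) auto
  moreover have "d (wedge_list ((\<alpha> # \<alpha>s) @ \<beta>s)) =
      (wedge (d (one_form \<alpha>)) (wedge_list (\<alpha>s @ \<beta>s)) - wedge (one_form \<alpha>) a) + (- wedge (one_form \<alpha>) b)"
    by (simp add: d_one_form_wedge ab(3) wedge_linear)
  ultimately show ?case
    by (metis add.commute length_Cons of_nat_Suc)
qed

text \<open>On pure forms the differential has no parts besides those of bidegrees \<open>(1, 0)\<close> and \<open>(0, 1)\<close>, by the
Leibniz rule and the bidegrees of the differentials of one-forms.\<close>
lemma d_split:
  assumes "\<omega> \<in> \<Lambda> p q"
  shows "\<exists>a\<in>\<Lambda> (p + 1) q. \<exists>b\<in>\<Lambda> p (q + 1). d \<omega> = a + b"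
  using assms
proof (induction rule: \<Lambda>_induct)
  case zero
  show ?case using \<Lambda>_zero[of "p + 1" q] \<Lambda>_zero[of p "q + 1"] by (force simp: d_linear)
next
  case (step c \<alpha>s \<beta>s \<omega>)
  obtain a b where ab: "a \<in> \<Lambda> (p + 1) q" "b \<in> \<Lambda> p (q + 1)" "d \<omega> = a + b"
    using step by auto
  obtain a' b' where ab': "a' \<in> \<Lambda> (p + 1) q" "b' \<in> \<Lambda> p (q + 1)" "d (wedge_list (\<alpha>s @ \<beta>s)) = a' + b'"
    using d_wedge_list_split[OF step(1,2)] step by auto
  have "d (scale_form c (wedge_list (\<alpha>s @ \<beta>s)) + \<omega>) = (scale_form c a' + a) + (scale_form c b' + b)"
    by (simp add: d_linear ab ab' form.scale_right_distrib)
  then show ?case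
    using ab ab' by (metis \<Lambda>_add \<Lambda>_scale)
qed

end

section \<open>Eigenvalues separating the bidegrees\<close>

text \<open>Modulo 5 the powers of \<open>2 + \<i>\<close> with positive exponents alternate between \<open>2 + \<i>\<close> and \<open>3 + 4\<i>\<close>.  Hence
\<open>2 + \<i>\<close> is not a real multiple of a root of unity, and a single scalar separates all bidegrees.\<close>
lemma Im_power_2_plus_i:
  assumes "k > 0"
  shows "Im ((2 + \<i>) ^ k) \<noteq> 0"
proof -
  have "\<exists>a b. (2 + \<i>) ^ Suc k = Complex (of_int a) (of_int b) \<and>
      (a mod 5 = 2 \<and> b mod 5 = 1 \<or> a mod 5 = 3 \<and> b mod 5 = 4)" for k
  proof (induction k)
    case 0
    show ?case by (rule exI[of _ 2], rule exI[of _ 1]) (simp add: complex_eq_iff)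
  next
    case (Suc k)
    then obtain a b where ab: "(2 + \<i>) ^ Suc k = Complex (of_int a) (of_int b)"
      "a mod 5 = 2 \<and> b mod 5 = 1 \<or> a mod 5 = 3 \<and> b mod 5 = 4"
      by blast
    have "(2 + \<i>) ^ Suc (Suc k) = Complex (of_int (2 * a - b)) (of_int (a + 2 * b))"
      by (subst power_Suc, subst ab) (simp add: complex_eq_iff)
    moreover have "(2 * a - b) mod 5 = 2 \<and> (a + 2 * b) mod 5 = 1 \<or>
        (2 * a - b) mod 5 = 3 \<and> (a + 2 * b) mod 5 = 4"
      using ab(2)
    proof (elim disjE conjE)
      assume "a mod 5 = 2" "b mod 5 = 1"
      then obtain m n where "a = 5 * m + 2" "b = 5 * n + 1"
        by (metis mult_div_mod_eq)
      then have "2 * a - b = 3 + (2 * m - n) * 5" "a + 2 * b = 4 + (m + 2 * n) * 5" by auto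
      then show ?thesis by (simp only: mod_mult_self1) simp
    next
      assume "a mod 5 = 3" "b mod 5 = 4"
      then obtain m n where "a = 5 * m + 3" "b = 5 * n + 4"
        by (metis mult_div_mod_eq)
      then have "2 * a - b = 2 + (2 * m - n) * 5" "a + 2 * b = 1 + (m + 2 * n + 2) * 5" by auto
      then show ?thesis by (simp only: mod_mult_self1) simp
    qed
    ultimately show ?case by blast
  qed
  from this[of "k - 1"] assms obtain a b where
    "(2 + \<i>) ^ k = Complex (of_int a) (of_int b)" "b mod 5 = 1 \<or> b mod 5 = 4"
    by auto
  then show ?thesis by auto
qed

text \<open>The scalar by which \<open>rescale\<close> acts on forms of bidegree \<open>(p, q)\<close>.\<close>
definition weight :: "nat \<Rightarrow> nat \<Rightarrow> complex" where
  "weight p q = (2 + \<i>) ^ p * cnj (2 + \<i>) ^ q"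

text \<open>The modulus of \<open>weight p q\<close> determines \<open>p + q\<close>.  If two weights with equal \<open>p + q\<close> agree, then a
power of \<open>2 + \<i>\<close> is real, which \<open>Im_power_2_plus_i\<close> allows only for the exponent 0.\<close>
lemma weight_inject:
  assumes "weight p q = weight p' q'"
  shows "p = p' \<and> q = q'"
proof -
  let ?z = "2 + \<i> :: complex"
  have z: "?z \<noteq> 0" "cmod ?z = sqrt 5"
    by (auto simp: complex_eq_iff cmod_def)
  have "cmod (weight p q) = sqrt 5 ^ (p + q)" for p q
    unfolding weight_def norm_mult norm_power complex_mod_cnj z(2) by (simp add: power_add)
  then have "sqrt 5 ^ (p + q) = sqrt 5 ^ (p' + q')"
    using assms by metis
  then have sum: "p + q = p' + q'"
    by (subst (asm) power_inject_exp) auto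
  have "p = p'" if hyp: "p' \<le> p" "p + q = p' + q'" "weight p q = weight p' q'" for p q p' q' :: nat
  proof (rule ccontr)
    assume "p \<noteq> p'"
    moreover define k where "k = p - p'"
    ultimately have k: "p = p' + k" "q' = q + k" "k > 0"
      using hyp(1,2) by auto
    have "?z ^ k = cnj ?z ^ k"
      using hyp(3) z(1) unfolding weight_def k by (simp add: power_add)
    then have "Im (?z ^ k) = 0"
      by (metis complex_cnj_power cnj.simps(2) neg_equal_zero)
    then show False
      using Im_power_2_plus_i[OF k(3)] by simp
  qed
  from this[of p' p q q'] this[of p p' q' q] show ?thesis
    using assms sum by (metis add_left_cancel nat_le_linear)
qed

text \<open>Substitution of \<open>(2 + \<i>) x\<close> for each argument \<open>x\<close>.  The scalar multiplication is a parameter.\<close>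
definition rescale :: "(complex \<Rightarrow> 'a \<Rightarrow> 'a) \<Rightarrow> 'a form \<Rightarrow> 'a form" where
  "rescale s \<omega> = (\<lambda>xs. \<omega> (map (s (2 + \<i>)) xs))"

lemma rescale_wedge: "rescale s (wedge \<alpha> \<beta>) = wedge (rescale s \<alpha>) (rescale s \<beta>)"
  by (simp add: fun_eq_iff rescale_def wedge_def nths_map)

lemma rescale_linear:
  "rescale s (\<alpha> + \<beta>) = rescale s \<alpha> + rescale s \<beta>" "rescale s (scale_form c \<alpha>) = scale_form c (rescale s \<alpha>)"
  "rescale s 0 = 0"
  by (simp_all add: fun_eq_iff rescale_def scale_form_def form_apply)

lemma rescale_sum: "rescale s (\<Sum>i\<in>A. f i) = (\<Sum>i\<in>A. rescale s (f i))"
  by (induction A rule: infinite_finite_induct) (simp_all add: rescale_linear)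

context complex_lie_algebra
begin

lemma rescale_one_form:
  "\<alpha> \<in> dual_10 \<Longrightarrow> rescale scale (one_form \<alpha>) = scale_form (2 + \<i>) (one_form \<alpha>)"
  "\<beta> \<in> dual_01 \<Longrightarrow> rescale scale (one_form \<beta>) = scale_form (cnj (2 + \<i>)) (one_form \<beta>)"
  by (auto simp: fun_eq_iff rescale_def one_form_def scale_form_def length_Suc_conv dual_10_iff dual_01_iff)

lemma rescale_wedge_list:
  assumes "set \<alpha>s \<subseteq> dual_10" "set \<beta>s \<subseteq> dual_01"
  shows "rescale scale (wedge_list (\<alpha>s @ \<beta>s)) = scale_form (weight (length \<alpha>s) (length \<beta>s)) (wedge_list (\<alpha>s @ \<beta>s))"
  using assms(1)
proof (induction \<alpha>s)
  case Nil
  show ?case using assms(2)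
  proof (induction \<beta>s)
    case Nil
    show ?case by (simp add: rescale_def unit_form_def fun_eq_iff weight_def scale_form_def)
  next
    case (Cons \<beta> \<beta>s)
    then show ?case
      by (simp add: rescale_wedge rescale_one_form wedge_linear weight_def mult_ac del: complex_cnj_add)
  qed
next
  case (Cons \<alpha> \<alpha>s)
  then show ?case
    by (simp add: rescale_wedge rescale_one_form wedge_linear weight_def mult_ac del: complex_cnj_add)
qed

lemma rescale_\<Lambda>: "\<omega> \<in> \<Lambda> p q \<Longrightarrow> rescale scale \<omega> = scale_form (weight (nat p) (nat q)) \<omega>"
proof (induction rule: \<Lambda>_induct)
  case (step c \<alpha>s \<beta>s \<omega>)
  then have "rescale scale (wedge_list (\<alpha>s @ \<beta>s)) = scale_form (weight (nat p) (nat q)) (wedge_list (\<alpha>s @ \<beta>s))"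
    using rescale_wedge_list[OF step(1,2)] by auto
  with step show ?case
    by (simp add: rescale_linear form.scale_right_distrib mult.commute)
qed (simp add: rescale_linear)

text \<open>Eigenvectors of \<open>rescale\<close> for different eigenvalues are independent.  Negative bidegrees have no
weight of their own, but contain only 0.\<close>
lemma \<Lambda>_sum_eq_0:
  assumes "finite K" "\<And>p q. f (p, q) \<in> \<Lambda> p q" "(\<Sum>k\<in>K. f k) = 0" "k \<in> K"
  shows "f k = 0"
  using assms
proof (induction K arbitrary: f k rule: finite_induct)
  case (insert k0 K)
  define w where "w k = weight (nat (fst k)) (nat (snd k))" for k
  \<comment> \<open>Applying \<open>rescale - w k0\<close> to the relation removes the summand \<open>k0\<close>.\<close>
  define g where "g k = scale_form (w k - w k0) (f k)" for k
  have rescale: "rescale scale (f k) = scale_form (w k) (f k)" for k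
    using insert.prems(1)[of "fst k" "snd k"] rescale_\<Lambda> unfolding w_def by simp
  have gz: "f k = 0" if "g k = 0" "k \<noteq> k0" "f k0 \<noteq> 0" for k
  proof (rule ccontr)
    assume "f k \<noteq> 0"
    then have "fst k \<ge> 0" "snd k \<ge> 0" "fst k0 \<ge> 0" "snd k0 \<ge> 0"
      using \<Lambda>_negative[OF insert.prems(1)[of "fst k" "snd k"]]
        \<Lambda>_negative[OF insert.prems(1)[of "fst k0" "snd k0"]] that(3) by force+
    moreover have "w k = w k0"
      using that(1) \<open>f k \<noteq> 0\<close> unfolding g_def by simp
    ultimately show False
      using that(2) weight_inject unfolding w_def by (metis nat_eq_iff prod_eqI)
  qed
  have sum: "f k0 + (\<Sum>k\<in>K. f k) = 0"
    using insert.prems(2) insert.hyps by simp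
  have fK: "f k = 0" if "k \<in> K" for k
  proof (cases "f k0 = 0")
    case True
    then show ?thesis using insert.IH[of f k] insert.prems(1) sum that by simp
  next
    case False
    have "(\<Sum>k\<in>K. g k) = rescale scale (f k0 + (\<Sum>k\<in>K. f k)) - scale_form (w k0) (f k0 + (\<Sum>k\<in>K. f k))"
      by (simp add: rescale_linear rescale_sum rescale g_def form.scale_left_diff_distrib form.scale_right_distrib
          form.scale_sum_right sum_subtractf)
    then have "(\<Sum>k\<in>K. g k) = 0"
      by (simp add: sum rescale_linear)
    then have "g k = 0"
      using insert.IH[of g k] insert.prems(1) that unfolding g_def by (simp add: \<Lambda>_scale)
    then show ?thesis
      using gz[of k] False that insert.hyps by auto
  qed
  with sum have "f k0 = 0" by simp
  with fK insert.prems(3) show ?case by (metis insertE)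
qed simp

end

section \<open>The operators del and delbar\<close>

context complex_lie_algebra
begin

text \<open>The function \<open>f\<close> is required to vanish outside \<open>K\<close>, so that decompositions over different index sets
can be compared without case distinctions.\<close>
lemma span_bidegrees_decompose:
  assumes "\<omega> \<in> form.span (\<Union>k\<in>A. \<Lambda> (fst k) (snd k))"
  shows "\<exists>K f. finite K \<and> K \<subseteq> A \<and> (\<forall>p q. f (p, q) \<in> \<Lambda> p q) \<and> (\<forall>k. k \<notin> K \<longrightarrow> f k = 0) \<and>
     \<omega> = (\<Sum>k\<in>K. f k)"
  using assms
proof (induction rule: form.span_induct_alt)
  case base
  show ?case
    by (rule exI[of _ "{}"], rule exI[of _ "\<lambda>_. 0"]) (simp add: \<Lambda>_zero)
next
  case (step c x y)
  then obtain K f where Kf: "finite K" "K \<subseteq> A" "\<And>p q. f (p, q) \<in> \<Lambda> p q" "\<And>k. k \<notin> K \<Longrightarrow> f k = 0"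
    "y = (\<Sum>k\<in>K. f k)" by auto
  from step obtain k0 where k0: "k0 \<in> A" "x \<in> \<Lambda> (fst k0) (snd k0)" by blast
  define g where "g = f(k0 := scale_form c x + f k0)"
  have "f k0 \<in> \<Lambda> (fst k0) (snd k0)" using Kf(3)[of "fst k0" "snd k0"] by simp
  then have "g (p, q) \<in> \<Lambda> p q" for p q
    using Kf(3) k0(2) unfolding g_def by (auto intro!: \<Lambda>_add \<Lambda>_scale)
  moreover have "g k = 0" if "k \<notin> insert k0 K" for k
    using that Kf(4) unfolding g_def by auto
  moreover have "scale_form c x + y = (\<Sum>k\<in>insert k0 K. g k)"
  proof -
    have "y = (\<Sum>k\<in>insert k0 K. f k)"
      unfolding Kf(5) using Kf(1,4) by (intro sum.mono_neutral_left) auto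
    also have "\<dots> = f k0 + (\<Sum>k\<in>K - {k0}. f k)"
      using Kf(1) by (simp add: sum.insert_remove)
    also have "(\<Sum>k\<in>K - {k0}. f k) = (\<Sum>k\<in>K - {k0}. g k)"
      by (rule sum.cong) (auto simp: g_def)
    finally show ?thesis
      using Kf(1) by (simp add: sum.insert_remove g_def add.assoc)
  qed
  ultimately show ?case
    using Kf(1,2) k0(1) by (intro exI[of _ "insert k0 K"] exI[of _ g]) auto
qed

lemma span_bidegrees_mono:
  "k \<in> A \<Longrightarrow> \<omega> \<in> \<Lambda> (fst k) (snd k) \<Longrightarrow> \<omega> \<in> form.span (\<Union>k\<in>A. \<Lambda> (fst k) (snd k))"
  by (rule form.span_base) blast

lemma \<Lambda>_Int_span_others:
  assumes "\<omega> \<in> \<Lambda> p q" "\<omega> \<in> form.span (\<Union>k\<in>A. \<Lambda> (fst k) (snd k))" "(p, q) \<notin> A"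
  shows "\<omega> = 0"
proof -
  obtain K f where Kf: "finite K" "K \<subseteq> A" "\<And>p q. f (p, q) \<in> \<Lambda> p q" "\<omega> = (\<Sum>k\<in>K. f k)"
    using span_bidegrees_decompose[OF assms(2)] by blast
  \<comment> \<open>A decomposition of 0 whose component of bidegree \<open>(p, q)\<close> is \<open>- \<omega>\<close>.\<close>
  define g where "g = f((p, q) := - \<omega>)"
  have "(\<Sum>k\<in>insert (p, q) K. g k) = - \<omega> + (\<Sum>k\<in>K. g k)"
    using Kf(1,2) assms(3) by (subst sum.insert) (auto simp: g_def)
  also have "(\<Sum>k\<in>K. g k) = \<omega>"
    unfolding Kf(4) using Kf(2) assms(3) by (intro sum.cong) (auto simp: g_def)
  finally have "(\<Sum>k\<in>insert (p, q) K. g k) = 0" by simp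
  moreover have "g (p', q') \<in> \<Lambda> p' q'" for p' q'
    using Kf(3) assms(1) by (auto simp: g_def \<Lambda>_neg)
  ultimately have "g (p, q) = 0"
    using \<Lambda>_sum_eq_0[of "insert (p, q) K" g] Kf(1) by blast
  then show ?thesis by (simp add: g_def)
qed

text \<open>The description in the definition of \<open>component\<close> determines it uniquely on sums of pure forms.\<close>
lemma component_sum:
  assumes "finite K" "\<And>p q. f (p, q) \<in> \<Lambda> p q" "\<And>k. k \<notin> K \<Longrightarrow> f k = 0"
  shows "component p q (\<Sum>k\<in>K. f k) = f (p, q)"
  unfolding component_def
proof (rule the_equality)
  let ?others = "\<Union>(p', q')\<in>- {(p, q)}. \<Lambda> p' q'"
  have others: "?others = (\<Union>k\<in>- {(p, q)}. \<Lambda> (fst k) (snd k))"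
    by (simp add: case_prod_beta')
  have "(\<Sum>k\<in>K. f k) = f (p, q) + (\<Sum>k\<in>K - {(p, q)}. f k)"
  proof (cases "(p, q) \<in> K")
    case True
    then show ?thesis using assms(1) by (simp add: sum.remove)
  next
    case False
    then show ?thesis using assms(3) by simp
  qed
  moreover have "(\<Sum>k\<in>K - {(p, q)}. f k) \<in> form.span ?others"
  proof (rule form.span_sum)
    fix k assume "k \<in> K - {(p, q)}"
    then show "f k \<in> form.span ?others"
      unfolding others using assms(2)[of "fst k" "snd k"] by (intro span_bidegrees_mono[of k]) auto
  qed
  ultimately have split: "(\<Sum>k\<in>K. f k) - f (p, q) \<in> form.span ?others"
    by simp
  with assms(2) show "f (p, q) \<in> \<Lambda> p q \<and> (\<Sum>k\<in>K. f k) - f (p, q) \<in> form.span ?others"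
    by simp
  fix \<eta> assume \<eta>: "\<eta> \<in> \<Lambda> p q \<and> (\<Sum>k\<in>K. f k) - \<eta> \<in> form.span ?others"
  then have "\<eta> - f (p, q) \<in> form.span ?others"
    using form.span_diff[OF split, of "(\<Sum>k\<in>K. f k) - \<eta>"] by simp
  moreover have "\<eta> - f (p, q) \<in> \<Lambda> p q"
    using \<eta> assms(2) by (simp add: \<Lambda>_diff)
  ultimately have "\<eta> - f (p, q) = 0"
    unfolding others by (intro \<Lambda>_Int_span_others[of _ p q "- {(p, q)}"]) auto
  then show "\<eta> = f (p, q)" by simp
qed

lemma component_0 [simp]: "component p q 0 = 0"
  using component_sum[of "{}" "\<lambda>_. 0" p q] by (simp add: \<Lambda>_zero)

lemma component_add_\<Lambda>:
  assumes "a \<in> \<Lambda> p q" "b \<in> \<Lambda> p' q'" "(p, q) \<noteq> (p', q')"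
  shows "component p q (a + b) = a" "component p' q' (a + b) = b"
proof -
  define f where "f k = (if k = (p, q) then a else if k = (p', q') then b else 0)" for k
  have "f (r, s) \<in> \<Lambda> r s" for r s
    using assms by (auto simp: f_def \<Lambda>_zero)
  moreover have "(\<Sum>k\<in>{(p, q), (p', q')}. f k) = a + b"
    using assms(3) by (auto simp: f_def)
  ultimately show "component p q (a + b) = a" "component p' q' (a + b) = b"
    using component_sum[of "{(p, q), (p', q')}" f] assms(3) by (auto simp: f_def)
qed

lemma del_delbar_sum:
  assumes "finite K" "\<And>p q. f (p, q) \<in> \<Lambda> p q" "\<And>k. k \<notin> K \<Longrightarrow> f k = 0"
  shows "del (\<Sum>k\<in>K. f k) = (\<Sum>k\<in>K. component (fst k + 1) (snd k) (d (f k)))"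
    and "delbar (\<Sum>k\<in>K. f k) = (\<Sum>k\<in>K. component (fst k) (snd k + 1) (d (f k)))"
proof -
  have K: "k \<in> K" if "f k \<noteq> 0" for k
    using assms(3) that by blast
  have c: "component (fst k) (snd k) (\<Sum>k\<in>K. f k) = f k" for k
    using component_sum[of K f, OF assms] by simp
  show "del (\<Sum>k\<in>K. f k) = (\<Sum>k\<in>K. component (fst k + 1) (snd k) (d (f k)))"
    unfolding del_def case_prod_beta' c
    by (rule sum.mono_neutral_left) (use assms(1) K in \<open>auto simp: d_linear\<close>)
  show "delbar (\<Sum>k\<in>K. f k) = (\<Sum>k\<in>K. component (fst k) (snd k + 1) (d (f k)))"
    unfolding delbar_def case_prod_beta' c
    by (rule sum.mono_neutral_left) (use assms(1) K in \<open>auto simp: d_linear\<close>)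
qed

lemma del_delbar_eq_component:
  assumes "\<omega> \<in> \<Lambda> p q"
  shows "del \<omega> = component (p + 1) q (d \<omega>)" "delbar \<omega> = component p (q + 1) (d \<omega>)"
  using del_delbar_sum[of "{(p, q)}" "\<lambda>k. if k = (p, q) then \<omega> else 0"] assms
  by (auto simp: \<Lambda>_zero)

lemma del_delbar_eqI:
  assumes "\<omega> \<in> \<Lambda> p q" "d \<omega> = a + b" "a \<in> \<Lambda> (p + 1) q" "b \<in> \<Lambda> p (q + 1)"
  shows "del \<omega> = a" "delbar \<omega> = b"
  using component_add_\<Lambda>[OF assms(3,4)] by (simp_all add: del_delbar_eq_component[OF assms(1)] assms(2))

lemma del_delbar_\<Lambda>:
  assumes "\<omega> \<in> \<Lambda> p q"
  shows "del \<omega> \<in> \<Lambda> (p + 1) q" "delbar \<omega> \<in> \<Lambda> p (q + 1)" "d \<omega> = del \<omega> + delbar \<omega>"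
  using d_split[OF assms] del_delbar_eqI[OF assms] by auto

lemma del_delbar_add:
  assumes "\<omega> \<in> \<Lambda> p q" "\<eta> \<in> \<Lambda> p q"
  shows "del (scale_form c \<omega> + \<eta>) = scale_form c (del \<omega>) + del \<eta>"
    "delbar (scale_form c \<omega> + \<eta>) = scale_form c (delbar \<omega>) + delbar \<eta>"
proof -
  have "d (scale_form c \<omega> + \<eta>) =
      (scale_form c (del \<omega>) + del \<eta>) + (scale_form c (delbar \<omega>) + delbar \<eta>)"
    by (simp add: d_linear del_delbar_\<Lambda>(3)[OF assms(1)] del_delbar_\<Lambda>(3)[OF assms(2)]
        form.scale_right_distrib)
  moreover have "scale_form c \<omega> + \<eta> \<in> \<Lambda> p q"
    "scale_form c (del \<omega>) + del \<eta> \<in> \<Lambda> (p + 1) q"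
    "scale_form c (delbar \<omega>) + delbar \<eta> \<in> \<Lambda> p (q + 1)"
    using assms del_delbar_\<Lambda> by (auto intro!: \<Lambda>_add \<Lambda>_scale)
  ultimately show "del (scale_form c \<omega> + \<eta>) = scale_form c (del \<omega>) + del \<eta>"
    "delbar (scale_form c \<omega> + \<eta>) = scale_form c (delbar \<omega>) + delbar \<eta>"
    using del_delbar_eqI by blast+
qed

lemma del_delbar_0 [simp]: "del 0 = 0" "delbar 0 = 0"
  using del_delbar_eqI[of 0 0 0 0 0] by (simp_all add: \<Lambda>_zero d_linear)

text \<open>Statements on the images of \<open>del\<close> and \<open>delbar\<close> reduce to forms of pure bidegree.\<close>
lemma del_delbar_in_subspace:
  assumes "\<omega> \<in> form.span (\<Union>k\<in>A. \<Lambda> (fst k) (snd k))" "form.subspace U"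
  shows "(\<And>p q \<eta>. (p, q) \<in> A \<Longrightarrow> \<eta> \<in> \<Lambda> p q \<Longrightarrow> del \<eta> \<in> U) \<Longrightarrow> del \<omega> \<in> U"
    and "(\<And>p q \<eta>. (p, q) \<in> A \<Longrightarrow> \<eta> \<in> \<Lambda> p q \<Longrightarrow> delbar \<eta> \<in> U) \<Longrightarrow> delbar \<omega> \<in> U"
proof -
  obtain K f where Kf: "finite K" "K \<subseteq> A" "\<And>p q. f (p, q) \<in> \<Lambda> p q" "\<And>k. k \<notin> K \<Longrightarrow> f k = 0"
    "\<omega> = (\<Sum>k\<in>K. f k)"
    using span_bidegrees_decompose[OF assms(1)] by blast
  have f: "f k \<in> \<Lambda> (fst k) (snd k)" for k using Kf(3)[of "fst k" "snd k"] by simp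
  have "del \<omega> = (\<Sum>k\<in>K. del (f k))" "delbar \<omega> = (\<Sum>k\<in>K. delbar (f k))"
    unfolding Kf(5) using del_delbar_sum[OF Kf(1,3,4)] del_delbar_eq_component[OF f] by simp_all
  then show "(\<And>p q \<eta>. (p, q) \<in> A \<Longrightarrow> \<eta> \<in> \<Lambda> p q \<Longrightarrow> del \<eta> \<in> U) \<Longrightarrow> del \<omega> \<in> U"
    and "(\<And>p q \<eta>. (p, q) \<in> A \<Longrightarrow> \<eta> \<in> \<Lambda> p q \<Longrightarrow> delbar \<eta> \<in> U) \<Longrightarrow> delbar \<omega> \<in> U"
    using Kf(2) f by (auto intro!: form.subspace_sum[OF assms(2)])
qed

text \<open>The parts are \<open>(\<gamma> - \<i> \<gamma> J) / 2\<close> and \<open>(\<gamma> + \<i> \<gamma> J) / 2\<close>.\<close>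
lemma dual_C_split:
  assumes "\<gamma> \<in> dual_C"
  shows "\<exists>\<alpha>\<in>dual_10. \<exists>\<beta>\<in>dual_01. one_form \<gamma> = one_form \<alpha> + one_form \<beta>"
proof
  have add: "\<gamma> (x + y) = \<gamma> x + \<gamma> y" and scale: "\<gamma> (scale (of_real r) x) = of_real r * \<gamma> x" for x y r
    using assms by (auto simp: dual_C_iff)
  have J: "J (x + y) = J x + J y" "J (scale (of_real r) x) = scale (of_real r) (J x)" "J (J x) = - x" for x y r
    by (simp_all add: J_def scale_right_distrib mult.commute)
  define \<alpha> \<beta> where "\<alpha> x = (\<gamma> x - \<i> * \<gamma> (J x)) / 2" and "\<beta> x = (\<gamma> x + \<i> * \<gamma> (J x)) / 2" for x
  show "\<alpha> \<in> dual_10"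
    unfolding dual_10_def dual_C_iff \<alpha>_def
    by (auto simp: add scale J additive_minus[of \<gamma>, OF add] field_simps)
  have "\<beta> \<in> dual_01"
    unfolding dual_01_def dual_C_iff \<beta>_def
    by (auto simp: add scale J additive_minus[of \<gamma>, OF add] field_simps)
  moreover have "one_form \<gamma> = one_form \<alpha> + one_form \<beta>"
    by (auto simp: fun_eq_iff one_form_def \<alpha>_def \<beta>_def form_apply field_simps)
  ultimately show "\<exists>\<beta>\<in>dual_01. one_form \<gamma> = one_form \<alpha> + one_form \<beta>" by blast
qed

lemma Ext_decompose: "Ext \<subseteq> form.span (\<Union>k\<in>{k. fst k \<ge> 0 \<and> snd k \<ge> 0}. \<Lambda> (fst k) (snd k))"
proof -
  let ?A = "{k :: int \<times> int. fst k \<ge> 0 \<and> snd k \<ge> 0}"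
  let ?S = "form.span (\<Union>k\<in>?A. \<Lambda> (fst k) (snd k))"
  have in_S: "\<omega> \<in> ?S" if "\<omega> \<in> \<Lambda> p q" "p \<ge> 0" "q \<ge> 0" for \<omega> p q
    using that by (intro span_bidegrees_mono[of "(p, q)"]) auto
  have wedge_S: "wedge (one_form \<gamma>) \<omega> \<in> ?S" if \<gamma>: "\<gamma> \<in> dual_C" and "\<omega> \<in> ?S" for \<gamma> \<omega>
    using that(2)
  proof (induction rule: form.span_induct_alt)
    case base
    show ?case by (simp add: wedge_linear form.span_zero)
  next
    case (step c x y)
    then obtain p q where x: "x \<in> \<Lambda> p q" "p \<ge> 0" "q \<ge> 0" by auto
    obtain \<alpha> \<beta> where "\<alpha> \<in> dual_10" "\<beta> \<in> dual_01" "one_form \<gamma> = one_form \<alpha> + one_form \<beta>"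
      using dual_C_split[OF \<gamma>] by blast
    then have "wedge (one_form \<gamma>) x \<in> ?S"
      using in_S[OF wedge_10[OF _ x(1)], of \<alpha>] in_S[OF wedge_01[OF _ x(1)], of \<beta>] x
      by (simp add: wedge_linear form.span_add)
    with step show ?case
      by (simp add: wedge_linear form.span_add form.span_scale)
  qed
  have "wedge_list \<alpha>s \<in> ?S" if "set \<alpha>s \<subseteq> dual_C" for \<alpha>s
    using that
  proof (induction \<alpha>s)
    case Nil
    show ?case using in_S[OF unit_form_\<Lambda>] by simp
  qed (use wedge_S in auto)
  then show ?thesis
    unfolding Ext_def by (intro form.span_minimal) (auto intro: form.subspace_span)
qed

lemma zero_in_Ext: "0 \<in> Ext"
  unfolding Ext_def by (rule form.span_zero)

lemma del_delbar_Ext: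
  assumes "\<omega> \<in> Ext"
  shows "del (delbar \<omega>) \<in> form.span (\<Union>k\<in>{k. fst k \<ge> 1 \<and> snd k \<ge> 1}. \<Lambda> (fst k) (snd k))"
proof -
  let ?A = "{k :: int \<times> int. fst k \<ge> 0 \<and> snd k \<ge> 1}"
  have "delbar \<omega> \<in> form.span (\<Union>k\<in>?A. \<Lambda> (fst k) (snd k))"
  proof (rule del_delbar_in_subspace(2)[OF subsetD[OF Ext_decompose assms] form.subspace_span])
    fix p q \<eta> assume "(p, q) \<in> {k :: int \<times> int. fst k \<ge> 0 \<and> snd k \<ge> 0}" "\<eta> \<in> \<Lambda> p q"
    then show "delbar \<eta> \<in> form.span (\<Union>k\<in>?A. \<Lambda> (fst k) (snd k))"
      using del_delbar_\<Lambda>(2) by (intro span_bidegrees_mono[of "(p, q + 1)"]) auto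
  qed
  then show ?thesis
  proof (rule del_delbar_in_subspace(1)[OF _ form.subspace_span])
    fix p q \<eta> assume "(p, q) \<in> ?A" "\<eta> \<in> \<Lambda> p q"
    then show "del \<eta> \<in> form.span (\<Union>k\<in>{k. fst k \<ge> 1 \<and> snd k \<ge> 1}. \<Lambda> (fst k) (snd k))"
      using del_delbar_\<Lambda>(1) by (intro span_bidegrees_mono[of "(p + 1, q)"]) auto
  qed
qed

text \<open>The image of \<open>del\<close> after \<open>delbar\<close> lies in bidegrees at least \<open>(1, 1)\<close>.  So Bott--Chern classes of bidegree
\<open>(p, 0)\<close> or \<open>(0, q)\<close> have only one representative.\<close>
lemma B_BC_eq_0:
  assumes "p < 1 \<or> q < 1"
  shows "B_BC p q = {0}"
proof
  show "{0} \<subseteq> B_BC p q"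
    unfolding B_BC_def using zero_in_Ext by (auto simp: \<Lambda>_zero image_iff intro!: bexI[of _ 0])
  show "B_BC p q \<subseteq> {0}"
    unfolding B_BC_def using \<Lambda>_Int_span_others[OF _ del_delbar_Ext] assms by fastforce
qed

text \<open>Only the components of bidegrees \<open>(p - 1, q)\<close> and \<open>(p, q - 1)\<close> contribute to the part of bidegree
\<open>(p, q)\<close> of \<open>del \<omega> + delbar \<omega>'\<close>; all other contributions lie in complementary bidegrees.\<close>
lemma B_A_eq_0:
  assumes "\<And>\<omega>. \<omega> \<in> \<Lambda> (p - 1) q \<Longrightarrow> del \<omega> = 0" "\<And>\<omega>. \<omega> \<in> \<Lambda> p (q - 1) \<Longrightarrow> delbar \<omega> = 0"
  shows "B_A p q = {0}"
proof
  show "{0} \<subseteq> B_A p q"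
    unfolding B_A_def set_plus_def using zero_in_Ext
    by (auto simp: \<Lambda>_zero image_iff intro!: bexI[of _ 0] exI[of _ 0])
  let ?S = "form.span (\<Union>k\<in>- {(p, q)}. \<Lambda> (fst k) (snd k))"
  have "del \<omega> \<in> ?S" if "\<omega> \<in> Ext" for \<omega>
  proof (rule del_delbar_in_subspace(1)[OF subsetD[OF Ext_decompose that] form.subspace_span])
    fix p' q' \<eta> assume \<eta>: "\<eta> \<in> \<Lambda> p' q'"
    show "del \<eta> \<in> ?S"
    proof (cases "(p' + 1, q') = (p, q)")
      case True
      then have "\<eta> \<in> \<Lambda> (p - 1) q" using \<eta> by auto
      then show ?thesis using assms(1) form.span_zero by simp
    next
      case False
      then show ?thesis
        using del_delbar_\<Lambda>(1)[OF \<eta>] by (intro span_bidegrees_mono[of "(p' + 1, q')"]) auto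
    qed
  qed
  moreover have "delbar \<omega> \<in> ?S" if "\<omega> \<in> Ext" for \<omega>
  proof (rule del_delbar_in_subspace(2)[OF subsetD[OF Ext_decompose that] form.subspace_span])
    fix p' q' \<eta> assume \<eta>: "\<eta> \<in> \<Lambda> p' q'"
    show "delbar \<eta> \<in> ?S"
    proof (cases "(p', q' + 1) = (p, q)")
      case True
      then have "\<eta> \<in> \<Lambda> p (q - 1)" using \<eta> by auto
      then show ?thesis using assms(2) form.span_zero by simp
    next
      case False
      then show ?thesis
        using del_delbar_\<Lambda>(2)[OF \<eta>] by (intro span_bidegrees_mono[of "(p', q' + 1)"]) auto
    qed
  qed
  ultimately have "x \<in> ?S" if "x \<in> del ` Ext + delbar ` Ext" for x
    using that by (auto simp: set_plus_def intro!: form.span_add)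
  then show "B_A p q \<subseteq> {0}"
    unfolding B_A_def using \<Lambda>_Int_span_others[of _ p q "- {(p, q)}"] by blast
qed

end

section \<open>Forms near the top degree of a unimodular algebra\<close>

lemma scale_form_apply: "scale_form c \<omega> xs = c * \<omega> xs"
  by (simp add: scale_form_def)

lemma wedge_one_form_vanish:
  "(\<And>x. x \<in> set xs \<Longrightarrow> \<alpha> x = 0) \<Longrightarrow> wedge (one_form \<alpha>) \<omega> xs = 0"
proof (induction xs arbitrary: \<omega>)
  case (Cons x xs)
  have "contract x (wedge (one_form \<alpha>) \<omega>) xs = 0"
    using Cons by (simp add: contract_one_form_wedge form_apply)
  then show ?case by (simp add: contract_def)
qed (simp add: wedge_Nil)

lemma grade_inv_wedge_list:
  "grade_inv (wedge_list \<alpha>s) = scale_form ((-1) ^ length \<alpha>s) (wedge_list \<alpha>s)"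
  by (induction \<alpha>s) (simp_all add: grade_inv_wedge wedge_linear)

context complex_lie_algebra
begin

definition complex_multilinear :: "'a form \<Rightarrow> bool" where
  "complex_multilinear \<omega> \<longleftrightarrow> (\<forall>us vs.
     (\<forall>x y. \<omega> (us @ (x + y) # vs) = \<omega> (us @ x # vs) + \<omega> (us @ y # vs)) \<and>
     (\<forall>c x. \<omega> (us @ scale c x # vs) = c * \<omega> (us @ x # vs)))"

lemma complex_multilinear_contract: "complex_multilinear \<omega> \<Longrightarrow> complex_multilinear (contract u \<omega>)"
  unfolding complex_multilinear_def contract_def by (metis append_Cons)

lemma complex_multilinear_wedge:
  assumes "\<alpha> \<in> dual_10" "complex_multilinear \<omega>"
  shows "complex_multilinear (wedge (one_form \<alpha>) \<omega>)"
proof -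
  have expand: "wedge (one_form \<alpha>) \<omega> (x # xs) = \<alpha> x * \<omega> xs - wedge (one_form \<alpha>) (contract x \<omega>) xs"
    for \<omega> x xs
    using fun_cong[OF contract_one_form_wedge[of x \<alpha> \<omega>], of xs]
    by (simp add: contract_def form_apply scale_form_def)
  have "wedge (one_form \<alpha>) \<omega> (us @ (x + y) # vs) =
      wedge (one_form \<alpha>) \<omega> (us @ x # vs) + wedge (one_form \<alpha>) \<omega> (us @ y # vs) \<and>
      wedge (one_form \<alpha>) \<omega> (us @ scale c x # vs) = c * wedge (one_form \<alpha>) \<omega> (us @ x # vs)" for us vs x y c
    using assms(2)
  proof (induction us arbitrary: \<omega>)
    case Nil
    have "\<omega> ([] @ (x + y) # vs) = \<omega> ([] @ x # vs) + \<omega> ([] @ y # vs)"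
      "\<omega> ([] @ scale c x # vs) = c * \<omega> ([] @ x # vs)" for vs
      using Nil unfolding complex_multilinear_def by blast+
    then have "contract (x + y) \<omega> = contract x \<omega> + contract y \<omega>"
      "contract (scale c x) \<omega> = scale_form c (contract x \<omega>)"
      by (simp_all add: fun_eq_iff contract_def scale_form_def form_apply)
    then show ?case
      using assms(1) by (simp add: expand wedge_linear form_apply dual_10_iff)
        (simp add: scale_form_def algebra_simps)
  next
    case (Cons u us)
    then have "complex_multilinear (contract u \<omega>)" by (simp add: complex_multilinear_contract)
    from Cons.IH[OF this] show ?case
      using Cons.prems unfolding complex_multilinear_def by (simp add: expand algebra_simps)
  qed
  then show ?thesis unfolding complex_multilinear_def by blast
qed

lemma complex_multilinear_wedge_list:
  "set \<alpha>s \<subseteq> dual_10 \<Longrightarrow> complex_multilinear (wedge_list \<alpha>s)"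
proof (induction \<alpha>s)
  case Nil
  show ?case by (simp add: complex_multilinear_def unit_form_def)
qed (simp add: complex_multilinear_wedge)

lemma \<Lambda>_complex_multilinear: "\<omega> \<in> \<Lambda> p 0 \<Longrightarrow> complex_multilinear \<omega>"
proof (induction rule: \<Lambda>_induct)
  case zero
  show ?case by (simp add: complex_multilinear_def form_apply)
next
  case (step c \<alpha>s \<beta>s \<omega>)
  then have "complex_multilinear (wedge_list (\<alpha>s @ \<beta>s))"
    by (simp add: complex_multilinear_wedge_list)
  with step(6) show ?case
    unfolding complex_multilinear_def by (simp add: form_apply scale_form_def algebra_simps)
qed

lemma complex_multilinear_expand:
  assumes "complex_multilinear \<omega>"
  shows "\<omega> (us @ x # vs) = (\<Sum>b\<in>Basis. coord b x * \<omega> (us @ b # vs))"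
  using dual_10_expand[of "\<lambda>x. \<omega> (us @ x # vs)" x] assms
  by (simp add: dual_10_iff complex_multilinear_def)

text \<open>By linearity the arguments may be taken from the basis, and a list with repetitions gives 0.\<close>
lemma alternating_multilinear_eq_0:
  assumes "alternating \<omega>" "complex_multilinear \<omega>"
    and "\<And>bs. distinct bs \<Longrightarrow> set bs \<subseteq> Basis \<Longrightarrow> \<omega> bs = 0"
  shows "\<omega> = 0"
proof
  fix xs
  have "\<omega> (bs @ xs) = 0" if "set bs \<subseteq> Basis" for bs
    using that
  proof (induction xs arbitrary: bs)
    case Nil
    then show ?case
      using assms(3)[of bs] alternating_not_distinct[OF assms(1), of bs] by auto
  next
    case (Cons x xs)
    have "\<omega> (bs @ b # xs) = 0" if "b \<in> Basis" for b
      using Cons.IH[of "bs @ [b]"] Cons.prems that by simp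
    then show ?case
      by (subst complex_multilinear_expand[OF assms(2)]) simp
  qed
  from this[of "[]"] show "\<omega> xs = 0 xs" by (simp add: form_apply)
qed

lemma \<Lambda>_above_dimension:
  assumes "\<omega> \<in> \<Lambda> p 0" "p > int (card Basis)"
  shows "\<omega> = 0"
proof (rule alternating_multilinear_eq_0)
  fix bs assume "distinct bs" "set bs \<subseteq> Basis"
  then have "length bs \<le> card Basis"
    using card_mono[OF finite_Basis] distinct_card by metis
  then show "\<omega> bs = 0"
    using assms(2) by (intro \<Lambda>_homogeneous[OF assms(1)]) auto
qed (use assms \<Lambda>_alternating \<Lambda>_complex_multilinear in auto)

lemma lie_wedge_list_10:
  "set \<alpha>s \<subseteq> dual_10 \<Longrightarrow> lie_derivative x (wedge_list \<alpha>s) \<in> \<Lambda> (int (length \<alpha>s)) 0"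
proof (induction \<alpha>s)
  case (Cons \<alpha> \<alpha>s)
  then have "wedge_list \<alpha>s \<in> \<Lambda> (int (length \<alpha>s)) 0"
    using \<Lambda>_generator[of \<alpha>s "[]"] by simp
  then have "wedge (one_form (\<lambda>y. - \<alpha> (bracket x y))) (wedge_list \<alpha>s) \<in> \<Lambda> (int (length \<alpha>s) + 1) 0"
    using Cons.prems by (intro wedge_10 dual_bracket) auto
  moreover have "wedge (one_form \<alpha>) (lie_derivative x (wedge_list \<alpha>s)) \<in> \<Lambda> (int (length \<alpha>s) + 1) 0"
    using Cons by (intro wedge_10) auto
  ultimately show ?case
    by (simp add: lie_wedge \<Lambda>_add add.commute)
qed (simp add: \<Lambda>_zero)

lemma lie_\<Lambda>_10: "\<omega> \<in> \<Lambda> p 0 \<Longrightarrow> lie_derivative x \<omega> \<in> \<Lambda> p 0"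
proof (induction rule: \<Lambda>_induct)
  case (step c \<alpha>s \<beta>s \<omega>)
  then have "lie_derivative x (wedge_list (\<alpha>s @ \<beta>s)) \<in> \<Lambda> p 0"
    using lie_wedge_list_10[of \<alpha>s x] by simp
  with step show ?case
    by (simp add: lie_linear \<Lambda>_add \<Lambda>_scale)
qed (simp add: lie_linear \<Lambda>_zero)

lemma trace_endo_bracket: "trace_endo (bracket x) = (\<Sum>b\<in>Basis. coord b (bracket x b))"
  by (simp add: trace_endo_def coord_def)

text \<open>On forms of top degree the Lie derivative along \<open>x\<close> is multiplication by \<open>- tr (ad x)\<close>: if one entry
\<open>b\<close> of an ordered basis is replaced by \<open>[x, b]\<close>, then only the coefficient of \<open>b\<close> in \<open>[x, b]\<close> survives.\<close>
lemma lie_top_form: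
  assumes "unimodular" "\<omega> \<in> \<Lambda> (int (card Basis)) 0"
  shows "lie_derivative x \<omega> = 0"
proof (rule alternating_multilinear_eq_0)
  have lie_derivative: "lie_derivative x \<omega> \<in> \<Lambda> (int (card Basis)) 0"
    by (rule lie_\<Lambda>_10[OF assms(2)])
  then show "alternating (lie_derivative x \<omega>)" "complex_multilinear (lie_derivative x \<omega>)"
    using \<Lambda>_alternating \<Lambda>_complex_multilinear by auto
  have alt: "alternating \<omega>" and lin: "complex_multilinear \<omega>"
    using assms(2) \<Lambda>_alternating \<Lambda>_complex_multilinear by auto
  fix bs assume bs: "distinct bs" "set bs \<subseteq> Basis"
  show "lie_derivative x \<omega> bs = 0"
  proof (cases "length bs = card Basis")
    case False
    then show ?thesis by (intro \<Lambda>_homogeneous[OF lie_derivative]) auto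
  next
    case True
    then have set: "set bs = Basis"
      using bs by (metis card_subset_eq distinct_card finite_Basis)
    have upd: "\<omega> (bs[i := y]) = coord (bs ! i) y * \<omega> bs" if "i < length bs" for i y
    proof -
      have "\<omega> (bs[i := y]) = (\<Sum>b\<in>Basis. coord b y * \<omega> (bs[i := b]))"
        using complex_multilinear_expand[OF lin, of "take i bs" y "drop (Suc i) bs"] that
        by (simp add: upd_conv_take_nth_drop)
      also have "\<dots> = (\<Sum>b\<in>Basis. if b = bs ! i then coord b y * \<omega> bs else 0)"
      proof (rule sum.cong[OF refl])
        fix b assume "b \<in> Basis"
        then obtain j where j: "j < length bs" "b = bs ! j"
          using set by (metis in_set_conv_nth)
        have "\<omega> (bs[i := b]) = 0" if "b \<noteq> bs ! i"
        proof (rule alternating_not_distinct[OF alt])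
          have "i \<noteq> j" using that j by auto
          moreover from this have "bs[i := b] ! i = bs[i := b] ! j"
            using j \<open>i < length bs\<close> by simp
          ultimately show "\<not> distinct (bs[i := b])"
            using j(1) \<open>i < length bs\<close> by (metis length_list_update nth_eq_iff_index_eq)
        qed
        then show "coord b y * \<omega> (bs[i := b]) = (if b = bs ! i then coord b y * \<omega> bs else 0)"
          by auto
      qed
      also have "\<dots> = coord (bs ! i) y * \<omega> bs"
        using that set by (subst sum.delta) (auto simp: finite_Basis)
      finally show ?thesis .
    qed
    have "lie_derivative x \<omega> bs = - (\<Sum>i<length bs. coord (bs ! i) (bracket x (bs ! i)) * \<omega> bs)"
      unfolding lie_derivative_def using upd by (intro arg_cong[of _ _ uminus] sum.cong) auto
    also have "\<dots> = - ((\<Sum>i<length bs. coord (bs ! i) (bracket x (bs ! i))) * \<omega> bs)"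
      by (simp add: sum_distrib_right)
    also have "(\<Sum>i<length bs. coord (bs ! i) (bracket x (bs ! i))) = trace_endo (bracket x)"
      using sum.reindex_bij_betw[OF bij_betw_nth[OF bs(1) refl refl], of "\<lambda>b. coord b (bracket x b)"]
      by (simp add: trace_endo_bracket set)
    finally show ?thesis
      using assms(1) by (simp add: unimodular_def)
  qed
qed

text \<open>Both sides are antiderivations in the list, so \<open>2 d = \<Sum> e\<^sub>b \<and> L\<^sub>b\<close> extends from one-forms.\<close>
lemma twice_d_wedge_list:
  assumes "set \<alpha>s \<subseteq> dual_10"
  shows "scale_form 2 (d (wedge_list \<alpha>s)) =
    (\<Sum>b\<in>Basis. wedge (one_form (coord b)) (lie_derivative b (wedge_list \<alpha>s)))"
  using assms
proof (induction \<alpha>s)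
  case Nil
  show ?case by (simp add: wedge_linear)
next
  case (Cons \<alpha> \<alpha>s)
  let ?\<omega> = "wedge_list \<alpha>s"
  have "scale_form 2 (d (one_form \<alpha>)) = (\<Sum>b\<in>Basis. wedge (one_form (coord b)) (lie_derivative b (one_form \<alpha>)))"
    using Cons.prems by (simp add: d_dual_10)
  then have "scale_form 2 (d (wedge_list (\<alpha> # \<alpha>s))) =
      wedge (\<Sum>b\<in>Basis. wedge (one_form (coord b)) (lie_derivative b (one_form \<alpha>))) ?\<omega>
      - wedge (one_form \<alpha>) (scale_form 2 (d ?\<omega>))"
    by (simp add: d_one_form_wedge wedge_linear form.scale_right_diff_distrib flip: wedge_linear(3))
  also have "\<dots> = (\<Sum>b\<in>Basis. wedge (one_form (coord b)) (wedge (lie_derivative b (one_form \<alpha>)) ?\<omega>))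
      - (\<Sum>b\<in>Basis. wedge (one_form \<alpha>) (wedge (one_form (coord b)) (lie_derivative b ?\<omega>)))"
    using Cons by (simp add: wedge_sum_left wedge_assoc wedge_sum_right)
  also have "\<dots> = (\<Sum>b\<in>Basis. wedge (one_form (coord b)) (lie_derivative b (wedge_list (\<alpha> # \<alpha>s))))"
    by (simp add: lie_wedge wedge_linear sum.distrib one_form_anticommute[of \<alpha>] sum_negf)
  finally show ?case .
qed

text \<open>In \<open>2 d\<tau> = \<Sum> e\<^sub>b \<and> L\<^sub>b \<tau>\<close> each summand equals \<open>L\<^sub>b (e\<^sub>b \<and> \<tau>) - L\<^sub>b e\<^sub>b \<and> \<tau>\<close>.  The first
part is the Lie derivative of a top form and vanishes; the functionals \<open>L\<^sub>b e\<^sub>b\<close> add up to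
\<open>y \<mapsto> tr (ad y) = 0\<close>.\<close>
lemma d_codimension_one:
  assumes "unimodular" "set \<alpha>s \<subseteq> dual_10" "Suc (length \<alpha>s) = card Basis"
  shows "d (wedge_list \<alpha>s) = 0"
proof -
  let ?\<tau> = "wedge_list \<alpha>s"
  have "?\<tau> \<in> \<Lambda> (int (length \<alpha>s)) 0"
    using \<Lambda>_generator[of \<alpha>s "[]"] assms(2) by simp
  then have "wedge (one_form (coord b)) ?\<tau> \<in> \<Lambda> (int (card Basis)) 0" for b
    using wedge_10[OF coord_dual_10, of ?\<tau>] assms(3) by (metis of_nat_Suc add.commute)
  then have "wedge (lie_derivative b (one_form (coord b))) ?\<tau> + wedge (one_form (coord b)) (lie_derivative b ?\<tau>) = 0" for b
    using lie_top_form[OF assms(1)] lie_wedge by metis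
  then have "wedge (one_form (coord b)) (lie_derivative b ?\<tau>) = - wedge (lie_derivative b (one_form (coord b))) ?\<tau>" for b
    by (metis add_eq_0_iff)
  then have "scale_form 2 (d ?\<tau>) = - wedge (\<Sum>b\<in>Basis. lie_derivative b (one_form (coord b))) ?\<tau>"
    by (simp add: twice_d_wedge_list[OF assms(2)] wedge_sum_left sum_negf)
  also have "(\<Sum>b\<in>Basis. lie_derivative b (one_form (coord b))) = 0"
  proof
    fix xs
    have "coord b (bracket b y) = - coord b (bracket y b)" for b y
      using bracket_antisym[of b y] coord_dual_10[of b] additive_minus[of "coord b"]
      by (simp add: dual_10_iff)
    then have "(\<Sum>b\<in>Basis. - coord b (bracket b y)) = 0" for y
      using assms(1) by (simp add: unimodular_def trace_endo_bracket)
    then show "(\<Sum>b\<in>Basis. lie_derivative b (one_form (coord b))) xs = 0 xs"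
      by (cases "length xs = 1") (simp_all add: sum_form_apply one_form_def form_apply)
  qed
  finally show ?thesis by (simp add: wedge_linear)
qed

lemma wedge_list_wedge:
  "set \<alpha>s \<subseteq> dual_10 \<Longrightarrow> \<omega> \<in> \<Lambda> p q \<Longrightarrow> wedge (wedge_list \<alpha>s) \<omega> \<in> \<Lambda> (int (length \<alpha>s) + p) q"
proof (induction \<alpha>s)
  case (Cons \<alpha> \<alpha>s)
  then have "wedge (one_form \<alpha>) (wedge (wedge_list \<alpha>s) \<omega>) \<in> \<Lambda> (int (length \<alpha>s) + p + 1) q"
    by (intro wedge_10) auto
  moreover have "int (length \<alpha>s) + p + 1 = int (length (\<alpha> # \<alpha>s)) + p" by simp
  ultimately show ?case by (simp only: wedge_list_simps wedge_assoc)
qed simp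

lemma delbar_\<Lambda>_p0: "\<omega> \<in> \<Lambda> p 0 \<Longrightarrow> delbar \<omega> = 0"
proof (induction rule: \<Lambda>_induct)
  case (step c \<alpha>s \<beta>s \<omega>)
  then have w: "wedge_list \<alpha>s \<in> \<Lambda> p 0" "d (wedge_list \<alpha>s) \<in> \<Lambda> (p + 1) 0"
    using \<Lambda>_generator[of \<alpha>s "[]"] d_wedge_list_10[of \<alpha>s] by auto
  have "delbar (wedge_list \<alpha>s) = 0"
    by (rule del_delbar_eqI(2)[OF w(1) _ w(2), of 0]) (simp_all add: \<Lambda>_zero)
  then show ?case
    using step del_delbar_add(2)[OF w(1) step(5)] by simp
qed simp

lemma del_\<Lambda>_0q: "\<omega> \<in> \<Lambda> 0 q \<Longrightarrow> del \<omega> = 0"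
proof (induction rule: \<Lambda>_induct)
  case (step c \<alpha>s \<beta>s \<omega>)
  then have w: "wedge_list \<beta>s \<in> \<Lambda> 0 q" "d (wedge_list \<beta>s) \<in> \<Lambda> 0 (q + 1)"
    using \<Lambda>_generator[of "[]" \<beta>s] d_wedge_list_01[of \<beta>s] by auto
  have "del (wedge_list \<beta>s) = 0"
    by (rule del_delbar_eqI(1)[OF w(1) _ _ w(2), of 0]) (simp_all add: \<Lambda>_zero)
  then show ?case
    using step del_delbar_add(1)[OF w(1) step(5)] by simp
qed simp

text \<open>For \<open>q = 1\<close> a generator is \<open>\<tau> \<and> \<beta>\<close> with a closed form \<open>\<tau>\<close> of bidegree \<open>(n - 1, 0)\<close>, so its differential is
\<open>\<plusminus> \<tau> \<and> d\<beta>\<close> and has no part of bidegree \<open>(n, q)\<close>.\<close>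
lemma del_codimension_one:
  assumes "unimodular" "\<omega> \<in> \<Lambda> (int (card Basis) - 1) q" "q = 0 \<or> q = 1"
  shows "del \<omega> = 0"
  using assms(2)
proof (induction rule: \<Lambda>_induct)
  case (step c \<alpha>s \<beta>s \<omega>)
  let ?\<tau> = "wedge_list \<alpha>s"
  have \<tau>: "d ?\<tau> = 0"
    using step by (intro d_codimension_one[OF assms(1)]) auto
  have "d (wedge_list \<beta>s) \<in> \<Lambda> 0 (q + 1)"
    using d_wedge_list_01[OF step(2)] step(4) by simp
  then have "wedge (grade_inv ?\<tau>) (d (wedge_list \<beta>s)) \<in> \<Lambda> (int (card Basis) - 1) (q + 1)"
    using wedge_list_wedge[OF step(1)] step(3) unfolding grade_inv_wedge_list wedge_linear
    by (metis \<Lambda>_scale add_0_right)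
  moreover have "d (wedge_list (\<alpha>s @ \<beta>s)) = 0 + wedge (grade_inv ?\<tau>) (d (wedge_list \<beta>s))"
    by (simp add: wedge_list_append d_wedge \<tau> wedge_linear)
  moreover have w: "wedge_list (\<alpha>s @ \<beta>s) \<in> \<Lambda> (int (card Basis) - 1) q"
    using step by (intro \<Lambda>_generator) auto
  ultimately have "del (wedge_list (\<alpha>s @ \<beta>s)) = 0"
    using del_delbar_eqI(1) \<Lambda>_zero by blast
  then show ?case
    using step del_delbar_add(1)[OF w step(5)] by simp
qed simp

section \<open>Contraction with antiholomorphic vectors\<close>

text \<open>Contraction with \<open>(x + \<i> J x) / 2\<close>, the part of type \<open>(0, 1)\<close> of \<open>x\<close>.  It kills complex linear
functionals and evaluates antilinear ones at \<open>x\<close>, so it separates the factors of a form of mixed type.\<close>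
definition contract_bar :: "'a \<Rightarrow> 'a form \<Rightarrow> 'a form" where
  "contract_bar x \<omega> = scale_form (1 / 2) (contract x \<omega> + scale_form \<i> (contract (J x) \<omega>))"

lemma contract_bar_linear:
  "contract_bar x (\<alpha> + \<beta>) = contract_bar x \<alpha> + contract_bar x \<beta>"
  "contract_bar x (scale_form c \<alpha>) = scale_form c (contract_bar x \<alpha>)"
  "contract_bar x 0 = 0" "contract_bar x (- \<alpha>) = - contract_bar x \<alpha>"
  by (simp_all add: contract_bar_def form.scale_right_distrib form.scale_right_diff_distrib mult.commute)

lemma contract_bar_wedge:
  "contract_bar x (wedge \<alpha> \<beta>) = wedge (contract_bar x \<alpha>) \<beta> + wedge (grade_inv \<alpha>) (contract_bar x \<beta>)"
  by (simp add: contract_bar_def contract_wedge wedge_linear form.scale_right_distrib)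

lemma contract_bar_one_form:
  "\<alpha> \<in> dual_10 \<Longrightarrow> contract_bar x (one_form \<alpha>) = 0"
  "\<beta> \<in> dual_01 \<Longrightarrow> contract_bar x (one_form \<beta>) = scale_form (\<beta> x) unit_form"
  by (simp_all add: contract_bar_def dual_10_def dual_01_def flip: form.scale_left_distrib)

lemma contract_bar_\<Lambda>_p0: "\<omega> \<in> \<Lambda> p 0 \<Longrightarrow> contract_bar x \<omega> = 0"
proof (induction rule: \<Lambda>_induct)
  case (step c \<alpha>s \<beta>s \<omega>)
  from step(1) have "contract_bar x (wedge_list \<alpha>s) = 0"
  proof (induction \<alpha>s)
    case Nil
    show ?case by (simp add: contract_bar_def)
  qed (simp add: contract_bar_wedge contract_bar_one_form wedge_linear)
  with step show ?case by (simp add: contract_bar_linear)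
qed (simp add: contract_bar_linear)

lemma contract_bar_d_01:
  assumes "\<beta> \<in> dual_01"
  shows "contract_bar x (d (one_form \<beta>)) = one_form (\<lambda>y. - \<beta> (bracket x y))"
  using assms
  by (auto simp: contract_bar_def contract_d_one_form fun_eq_iff scale_form_def form_apply
      one_form_def J_def bracket_scale_left dual_01_iff)

lemma del_delbar_wedge:
  assumes "\<beta> \<in> dual_01" "\<alpha> \<in> dual_10"
  shows "del (delbar (wedge (one_form \<beta>) (one_form \<alpha>))) = wedge (d (one_form \<beta>)) (d (one_form \<alpha>))"
proof -
  have add: "\<And>x y. \<beta> (x + y) = \<beta> x + \<beta> y" "\<And>x y. \<alpha> (x + y) = \<alpha> x + \<alpha> y"
    using assms by (auto simp: dual_10_iff dual_01_iff)
  have w11: "wedge (one_form \<beta>) (one_form \<alpha>) \<in> \<Lambda> 1 1"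
    using wedge_01[OF assms(1) one_form_10[OF assms(2)]] by simp
  have w12: "wedge (d (one_form \<beta>)) (one_form \<alpha>) \<in> \<Lambda> 1 2"
    using wedge_d_01[OF assms(1) one_form_10[OF assms(2)]] by simp
  have w21: "- wedge (one_form \<beta>) (d (one_form \<alpha>)) \<in> \<Lambda> 2 1"
    using wedge_01[OF assms(1) d_one_form_10[OF assms(2)]] by (simp add: \<Lambda>_neg)
  have w22: "wedge (d (one_form \<beta>)) (d (one_form \<alpha>)) \<in> \<Lambda> 2 2"
    using wedge_d_01[OF assms(1) d_one_form_10[OF assms(2)]] by simp
  have "d (wedge (one_form \<beta>) (one_form \<alpha>)) =
      - wedge (one_form \<beta>) (d (one_form \<alpha>)) + wedge (d (one_form \<beta>)) (one_form \<alpha>)"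
    by (simp add: d_one_form_wedge)
  then have "delbar (wedge (one_form \<beta>) (one_form \<alpha>)) = wedge (d (one_form \<beta>)) (one_form \<alpha>)"
    using del_delbar_eqI(2)[OF w11, of "- wedge (one_form \<beta>) (d (one_form \<alpha>))"] w12 w21 by simp
  moreover have "d (wedge (d (one_form \<beta>)) (one_form \<alpha>)) = wedge (d (one_form \<beta>)) (d (one_form \<alpha>)) + 0"
  proof -
    have "grade_inv (d (one_form \<beta>)) = d (one_form \<beta>)"
      using d_grade_inv[of "one_form \<beta>"] by (simp add: d_linear)
    then show ?thesis
      by (simp add: d_wedge alternating_d_one_form[of \<beta>, OF add(1)] d_d_one_form[of \<beta>, OF add(1)] wedge_linear)
  qed
  ultimately show ?thesis
    using del_delbar_eqI(1)[OF w12 _ _ \<Lambda>_zero, of "wedge (d (one_form \<beta>)) (d (one_form \<alpha>))"] w22 by simp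
qed

text \<open>The generators are written with the antilinear factor in front, since \<open>contract_bar\<close> then produces no signs.\<close>
lemma \<Lambda>11_induct [consumes 1, case_names zero step]:
  assumes "\<xi> \<in> \<Lambda> 1 1" "P 0"
    and "\<And>c \<beta> \<alpha> \<eta>. \<lbrakk>\<beta> \<in> dual_01; \<alpha> \<in> dual_10; \<eta> \<in> \<Lambda> 1 1; P \<eta>\<rbrakk>
      \<Longrightarrow> P (scale_form c (wedge (one_form \<beta>) (one_form \<alpha>)) + \<eta>)"
  shows "P \<xi>"
  using assms(1)
proof (induction rule: \<Lambda>_induct)
  case (step c \<alpha>s \<beta>s \<omega>)
  then obtain \<alpha> \<beta> where \<alpha>\<beta>: "\<alpha>s = [\<alpha>]" "\<beta>s = [\<beta>]" "\<alpha> \<in> dual_10" "\<beta> \<in> dual_01"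
    by (auto simp: length_Suc_conv)
  have "wedge (one_form \<alpha>) (one_form \<beta>) = - wedge (one_form \<beta>) (one_form \<alpha>)"
    using one_form_anticommute[of \<alpha> \<beta> unit_form] by simp
  then have "scale_form c (wedge_list (\<alpha>s @ \<beta>s)) = scale_form (- c) (wedge (one_form \<beta>) (one_form \<alpha>))"
    by (simp add: \<alpha>\<beta>)
  then show ?case
    using assms(3)[OF \<alpha>\<beta>(4,3) step(5,6), of "- c"] by simp
qed (rule assms(2))

lemma contract_bar_wedge_01_10:
  assumes "\<beta> \<in> dual_01" "\<alpha> \<in> dual_10"
  shows "contract_bar x (wedge (one_form \<beta>) (one_form \<alpha>)) = scale_form (\<beta> x) (one_form \<alpha>)"
  using assms by (simp add: contract_bar_wedge contract_bar_one_form wedge_linear)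

text \<open>The value of \<open>del (delbar \<xi>)\<close> on antilinear arguments \<open>z\<close>, \<open>w\<close> and linear arguments \<open>x\<close>, \<open>y\<close> is the value of
\<open>\<xi>\<close> at \<open>[z, w]\<close> and \<open>[x, y]\<close>.  For \<open>\<xi> = \<beta> \<and> \<alpha>\<close> this is \<open>d\<beta>(z, w) d\<alpha>(x, y) = \<beta>([z, w]) \<alpha>([x, y])\<close>.\<close>
lemma del_delbar_bracket:
  assumes "\<xi> \<in> \<Lambda> 1 1"
  shows "contract_bar w (contract_bar z (del (delbar \<xi>))) [x, y] =
    contract_bar (bracket z w) \<xi> [bracket x y]"
  using assms
proof (induction rule: \<Lambda>11_induct)
  case zero
  show ?case by (simp only: contract_bar_linear del_delbar_0) (simp only: zero_fun_apply)
next
  case (step c \<beta> \<alpha> \<eta>)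
  let ?\<zeta> = "wedge (one_form \<beta>) (one_form \<alpha>)"
  have \<zeta>: "?\<zeta> \<in> \<Lambda> 1 1"
    using wedge_01[OF step(1) one_form_10[OF step(2)]] by simp
  have "contract_bar w (contract_bar z (del (delbar ?\<zeta>))) =
      scale_form (- \<beta> (bracket z w)) (d (one_form \<alpha>))"
    using step contract_bar_\<Lambda>_p0[OF d_one_form_10[OF step(2)]]
    by (simp add: del_delbar_wedge contract_bar_wedge contract_bar_d_01 contract_bar_one_form(2)
        dual_bracket wedge_linear)
  moreover have "d (one_form \<alpha>) [x, y] = - \<alpha> (bracket x y)"
    using fun_cong[OF contract_d_one_form[of x \<alpha>], of "[y]"] by (simp add: contract_def)
  ultimately have "contract_bar w (contract_bar z (del (delbar ?\<zeta>))) [x, y] =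
      contract_bar (bracket z w) ?\<zeta> [bracket x y]"
    using step by (simp add: contract_bar_wedge_01_10 scale_form_def)
  then show ?case
    using step(4) del_delbar_add(2)[OF \<zeta> step(3)]
      del_delbar_add(1)[OF del_delbar_\<Lambda>(2)[OF \<zeta>] del_delbar_\<Lambda>(2)[OF step(3)]]
    by (simp add: contract_bar_linear) (simp add: form_apply scale_form_apply)
qed

lemma contract_wedge_list_10:
  "set \<alpha>s \<subseteq> dual_10 \<Longrightarrow> contract x (wedge_list \<alpha>s) \<in> \<Lambda> (int (length \<alpha>s) - 1) 0"
proof (induction \<alpha>s)
  case (Cons \<alpha> \<alpha>s)
  have "wedge_list \<alpha>s \<in> \<Lambda> (int (length \<alpha>s)) 0"
    using \<Lambda>_generator[of \<alpha>s "[]"] Cons.prems by simp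
  moreover have "wedge (one_form \<alpha>) (contract x (wedge_list \<alpha>s)) \<in> \<Lambda> (int (length \<alpha>s)) 0"
    using wedge_10[of \<alpha> "contract x (wedge_list \<alpha>s)" "int (length \<alpha>s) - 1" 0] Cons by simp
  ultimately show ?case
    by (simp add: contract_one_form_wedge \<Lambda>_diff \<Lambda>_scale)
qed (simp add: \<Lambda>_zero)

text \<open>Contraction of \<open>\<alpha> \<and> \<omega> = 0\<close>, a form above the top degree.\<close>
lemma wedge_contract_top:
  assumes "\<alpha> \<in> dual_10" "\<omega> \<in> \<Lambda> (int (card Basis)) 0"
  shows "wedge (one_form \<alpha>) (contract x \<omega>) = scale_form (\<alpha> x) \<omega>"
proof -
  have "wedge (one_form \<alpha>) \<omega> = 0"
    by (rule \<Lambda>_above_dimension[OF wedge_10[OF assms]]) simp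
  then have "contract x (wedge (one_form \<alpha>) \<omega>) = 0" by simp
  then show ?thesis by (simp add: contract_one_form_wedge)
qed

text \<open>The product of a \<open>(1, 1)\<close>-form with \<open>\<iota>\<^sub>x \<omega>\<close> is governed by the values of the \<open>(1, 1)\<close>-form whose linear argument
is \<open>x\<close>.\<close>
lemma contract_bar_wedge_contract_top:
  assumes "\<xi> \<in> \<Lambda> 1 1" "\<omega> \<in> \<Lambda> (int (card Basis)) 0" "contract x \<omega> \<in> \<Lambda> p 0"
  shows "contract_bar y (wedge \<xi> (contract x \<omega>)) = scale_form (contract_bar y \<xi> [x]) \<omega>"
  using assms(1)
proof (induction rule: \<Lambda>11_induct)
  case zero
  show ?case
    by (simp only: contract_bar_linear wedge_linear) (simp add: zero_fun_apply[of "[x]"])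
next
  case (step c \<beta> \<alpha> \<eta>)
  have "contract_bar y (wedge (wedge (one_form \<beta>) (one_form \<alpha>)) (contract x \<omega>)) =
      scale_form (\<beta> y * \<alpha> x) \<omega>"
    using step contract_bar_\<Lambda>_p0[OF assms(3)]
    by (simp add: contract_bar_wedge[of _ "wedge (one_form \<beta>) (one_form \<alpha>)"] contract_bar_wedge_01_10
        wedge_linear wedge_contract_top[OF _ assms(2)])
  then show ?case
    using step by (simp add: contract_bar_linear wedge_linear contract_bar_wedge_01_10)
        (simp add: plus_fun_apply scale_form_apply form.scale_left_distrib mult.assoc)
qed

lemma wedge_list_coord:
  "distinct bs \<Longrightarrow> set bs \<subseteq> Basis \<Longrightarrow> wedge_list (map coord bs) bs = 1"
proof (induction bs)
  case (Cons b bs)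
  have "wedge (one_form (coord b)) (contract b (wedge_list (map coord bs))) bs = 0"
    using Cons.prems by (intro wedge_one_form_vanish) (auto simp: coord_Basis)
  then have "contract b (wedge (one_form (coord b)) (wedge_list (map coord bs))) bs = 1"
    using Cons by (simp add: contract_one_form_wedge form_apply scale_form_def coord_Basis)
  then show ?case by (simp add: contract_def)
qed simp

section \<open>The Massey product\<close>

text \<open>All spaces of exact forms that occur are zero, so every class involved is a singleton and the
question is whether \<open>- f \<and> \<tau>\<close> equals some \<open>\<xi> \<and> \<tau>\<close> with \<open>del (delbar \<xi>) = 0\<close>.  Contraction with the antilinear
part of \<open>X\<close> tells the two apart: it gives \<open>- \<beta> X * \<alpha> X\<close> times \<open>vol\<close> in the first case and, \<open>X\<close> being a bracket, 0 in
the second.\<close>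
lemma ABC_Massey_nonvanishing:
  assumes "\<not> abelian" "unimodular"
  shows "admits_nonvanishing_ABC_Massey"
proof -
  obtain x y where X0: "bracket x y \<noteq> 0"
    using assms(1) by (auto simp: abelian_def)
  define X where "X = bracket x y"
  obtain b0 where b0: "b0 \<in> Basis" "coord b0 X \<noteq> 0"
  proof (rule ccontr)
    assume "\<not> thesis"
    then have "\<forall>b\<in>Basis. coord b X = 0" using that by blast
    then have "(\<Sum>b\<in>Basis. scale (coord b X) b) = 0" by simp
    then show False using X0 sum_coord[of X] by (simp add: X_def)
  qed
  define \<alpha> \<beta> where "\<alpha> = coord b0" and "\<beta> = (\<lambda>z. cnj (\<alpha> z))"
  have \<alpha>: "\<alpha> \<in> dual_10" and \<beta>: "\<beta> \<in> dual_01"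
    using coord_dual_10 dual_01_cnj by (auto simp: \<alpha>_def \<beta>_def)
  obtain bs where bs: "set bs = Basis" "distinct bs"
    using finite_distinct_list[OF finite_Basis] by blast
  define n where "n = card Basis"
  \<comment> \<open>As the algebra is nonzero, the natural number \<open>n - 1\<close> is not truncated.\<close>
  have n: "length bs = n" "n \<ge> 1"
    using bs distinct_card[OF bs(2)] b0(1) finite_Basis by (auto simp: n_def Suc_le_eq card_gt_0_iff)
  define vol where "vol = wedge_list (map coord bs)"
  have vol: "vol \<in> \<Lambda> (int n) 0" "vol bs = 1"
    using \<Lambda>_generator[of "map coord bs" "[]"] coord_dual_10 wedge_list_coord[of bs] bs n
    by (auto simp: vol_def)
  define \<tau> where "\<tau> = contract X vol"
  have \<tau>: "\<tau> \<in> \<Lambda> (int n - 1) 0"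
    using contract_wedge_list_10[of "map coord bs" X] coord_dual_10 n by (auto simp: \<tau>_def vol_def)
  define f where "f = wedge (one_form \<beta>) (one_form \<alpha>)"
  have f: "f \<in> \<Lambda> 1 1"
    using wedge_01[OF \<beta> one_form_10[OF \<alpha>]] by (simp add: f_def)
  have key: "contract_bar X (wedge \<xi> \<tau>) = scale_form (contract_bar X \<xi> [X]) vol" if "\<xi> \<in> \<Lambda> 1 1" for \<xi>
    using contract_bar_wedge_contract_top[OF that] vol(1) \<tau> unfolding \<tau>_def n_def by blast

  have B_A1: "B_A (int n) 1 = {0}"
    using del_codimension_one[OF assms(2)] delbar_\<Lambda>_p0 unfolding n_def by (intro B_A_eq_0) auto
  have B_A2: "B_A 1 1 = {0}"
    using del_\<Lambda>_0q delbar_\<Lambda>_p0 by (intro B_A_eq_0) auto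
  have coset: "\<omega> +o {0} = {\<omega>}" for \<omega> :: "'a form"
    by (simp add: elt_set_plus_def)

  define a12 a23 a34 where "a12 = {d (one_form \<beta>)}" and "a23 = {d (one_form \<alpha>)}" and "a34 = {\<tau>}"
  have dd: "d (d (one_form \<alpha>)) = 0" "d (d (one_form \<beta>)) = 0"
    using \<alpha> \<beta> by (auto intro!: d_d_one_form simp: dual_10_iff dual_01_iff)
  have "a12 \<in> H_BC 0 2"
    using d_one_form_01[OF \<beta>] del_delbar_eqI[OF d_one_form_01[OF \<beta>], of 0 0] dd
    unfolding H_BC_def Z_BC_def a12_def by (auto simp: B_BC_eq_0 coset \<Lambda>_zero intro!: exI[of _ "d (one_form \<beta>)"])
  moreover have "a23 \<in> H_BC 2 0"
    using d_one_form_10[OF \<alpha>] del_delbar_eqI[OF d_one_form_10[OF \<alpha>], of 0 0] dd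
    unfolding H_BC_def Z_BC_def a23_def by (auto simp: B_BC_eq_0 coset \<Lambda>_zero intro!: exI[of _ "d (one_form \<alpha>)"])
  moreover have "a34 \<in> H_BC (int n - 1) 0"
    using \<tau> del_codimension_one[OF assms(2), of \<tau> 0] delbar_\<Lambda>_p0[OF \<tau>]
    unfolding H_BC_def Z_BC_def a34_def n_def by (auto simp: B_BC_eq_0 coset intro!: exI[of _ \<tau>])
  moreover have "wedge (d (one_form \<beta>)) (d (one_form \<alpha>)) = del (delbar f)"
    using del_delbar_wedge[OF \<beta> \<alpha>] by (simp add: f_def)
  moreover have "wedge (d (one_form \<alpha>)) \<tau> = 0"
    using \<Lambda>_above_dimension[OF wedge_d_10[OF \<alpha> \<tau>]] by (simp add: n_def)
  ultimately have Massey: "is_ABC_Massey 0 2 2 0 (n - 1) 0 a12 a23 a34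
      (((- wedge f \<tau>) +o B_A (int n) 1) +o ABC_indeterminacy 0 2 2 0 (n - 1) 0 a12 a34)"
    unfolding is_ABC_Massey_def using f n(2) \<Lambda>_zero[of "int n" "-1"]
    by (intro conjI, simp_all add: of_nat_diff)
      (rule bexI[of _ "d (one_form \<beta>)"], rule bexI[of _ "d (one_form \<alpha>)"], rule bexI[of _ \<tau>],
        rule bexI[of _ f], rule conjI, simp, rule bexI[of _ 0], simp_all add: wedge_linear a12_def a23_def a34_def)

  have indet: "ABC_indeterminacy 0 2 2 0 (n - 1) 0 a12 a34 = {{wedge \<xi> \<tau>} | \<xi>. \<xi> \<in> Z_A 1 1}"
  proof -
    have "\<Lambda> (int n) (-1) = {0}"
      using \<Lambda>_negative[of _ "int n" "-1"] \<Lambda>_zero by auto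
    moreover from this have "B_A (int n) (-1) = {0}"
      unfolding B_A_def set_plus_def using zero_in_Ext
      by (auto simp: image_iff intro!: bexI[of _ 0] exI[of _ 0])
    ultimately have H1: "H_A (int n) (-1) = {{0}}"
      unfolding H_A_def Z_A_def by (auto simp: coset)
    have H2: "H_A 1 1 = {{\<xi>} | \<xi>. \<xi> \<in> Z_A 1 1}"
      unfolding H_A_def B_A2 coset ..
    have cup: "cup_A (int n) 1 {\<xi>} {\<eta>} = {wedge \<xi> \<eta>}" for \<xi> \<eta>
      unfolding cup_A_def B_A1 coset by simp
    have "ABC_indeterminacy 0 2 2 0 (n - 1) 0 a12 a34 =
        cup_A (int n) 1 a12 ` H_A (int n) (-1) + (\<lambda>h. cup_A (int n) 1 h a34) ` H_A 1 1"
      using n(2) by (simp add: ABC_indeterminacy_def of_nat_diff)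
    also have "\<dots> = {{0}} + {{wedge \<xi> \<tau>} | \<xi>. \<xi> \<in> Z_A 1 1}"
      unfolding H1 H2 a12_def a34_def setcompr_eq_image image_image cup by (simp add: cup wedge_linear)
    also have "\<dots> = {{wedge \<xi> \<tau>} | \<xi>. \<xi> \<in> Z_A 1 1}"
      by (auto simp: set_plus_def)
    finally show ?thesis .
  qed

  have "((- wedge f \<tau>) +o B_A (int n) 1) +o ABC_indeterminacy 0 2 2 0 (n - 1) 0 a12 a34
      \<noteq> ABC_indeterminacy 0 2 2 0 (n - 1) 0 a12 a34"
  proof
    assume eq: "((- wedge f \<tau>) +o B_A (int n) 1) +o ABC_indeterminacy 0 2 2 0 (n - 1) 0 a12 a34
      = ABC_indeterminacy 0 2 2 0 (n - 1) 0 a12 a34"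
    have "0 \<in> Z_A 1 1"
      by (simp add: Z_A_def \<Lambda>_zero)
    \<comment> \<open>The indeterminacy contains the class of 0.  If it were invariant under translation by the class
      of the representative, it would contain that class too.\<close>
    then have "{wedge 0 \<tau>} \<in> {{wedge \<xi> \<tau>} | \<xi>. \<xi> \<in> Z_A 1 1}"
      by blast
    then have "{0} \<in> ABC_indeterminacy 0 2 2 0 (n - 1) 0 a12 a34"
      unfolding indet wedge_linear(5) .
    then have "{- wedge f \<tau>} + {0} \<in> ABC_indeterminacy 0 2 2 0 (n - 1) 0 a12 a34"
      by (subst eq[symmetric], unfold B_A1 coset) (rule set_plus_intro2)
    then obtain \<xi> where \<xi>: "\<xi> \<in> Z_A 1 1" "- wedge f \<tau> = wedge \<xi> \<tau>"
      unfolding indet by (auto simp: set_plus_def)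
    \<comment> \<open>The bracket \<open>X\<close> takes both slots of \<open>\<xi>\<close>, the linear and the antilinear one.\<close>
    have "contract_bar X \<xi> [X] = 0"
      using \<xi>(1) del_delbar_bracket[of \<xi> y x x y]
      by (simp add: Z_A_def X_def contract_bar_linear form_apply)
    then have "contract_bar X (wedge \<xi> \<tau>) = 0"
      using key[of \<xi>] \<xi>(1) by (simp add: Z_A_def)
    then have "contract_bar X (wedge f \<tau>) = 0"
      using \<xi>(2) by (metis contract_bar_linear(4) neg_equal_0_iff_equal)
    then have "scale_form (\<beta> X * \<alpha> X) vol bs = 0"
      using key[OF f] contract_bar_wedge_01_10[OF \<beta> \<alpha>] by (simp add: f_def scale_form_def form_apply)
    then show False
      using vol(2) b0(2) by (simp add: scale_form_def \<alpha>_def \<beta>_def)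
  qed
  with Massey show ?thesis
    unfolding admits_nonvanishing_ABC_Massey_def by blast
qed

end

theorem theorem4p2:
  fixes scale :: "complex \<Rightarrow> 'a::ab_group_add \<Rightarrow> 'a"
    and Basis :: "'a set"
    and bracket :: "'a \<Rightarrow> 'a \<Rightarrow> 'a"
  assumes "complex_lie_algebra scale Basis bracket"
    and "\<not> complex_lie_algebra.abelian bracket"
    and "complex_lie_algebra.unimodular scale Basis bracket"
    and "complex_lie_algebra.solvable scale bracket"
  shows "complex_lie_algebra.admits_nonvanishing_ABC_Massey scale bracket"
  using complex_lie_algebra.ABC_Massey_nonvanishing[OF assms(1-3)] .

end
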